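(* Let $n\ge2$ be an integer and $p$ a prime with $(p,n+1)=1$. Let $F(x)$ and $H(x)$ be as in the context, and let $$F_i(x)=\frac{d^i}{dx^i}F(x)$$ be the $i$-th derivative of $F(x)$. Then the series $$f_i(x)=\frac{F_i(x)}{F(x)}$$ are in fact elements of the $p$-adic completion of $\mathbb{Z}_p[x,(x(1-x)H(x))^{-1}]$ for all $i\ge0$.
   Context: $F(x)$ is the hypergeometric series $$F(x)=\sum_{r=0}^\infty\frac{\left(\frac1{n+1}\right)_r\left(\frac2{n+1}\right)_r\cdots\left(\frac n{n+1}\right)_r}{(r!)^n}x^r,$$ where $(a)_0=1$ and $(a)_r=a(a+1)\cdots(a+r-1)$ for $r>0$. Its coefficients lie in $\mathbb{Z}[\frac1{n+1}]\subset\mathbb{Z}_p$, so $f_i(x)\in\mathbb{Z}_p[[x]]$. $H(x)=F^{<p}(x)$ is the truncation of $F(x)$ to terms of degree $\le p-1$, regarded here as a polynomial over $\mathbb{Z}_p$. Since $H(0)=1$, both $\mathbb{Z}_p[[x]]$ and the $p$-adic completion of $\mathbb{Z}_p[x,(x(1-x)H(x))^{-1}]$ embed into the $p$-adic completion of $\mathbb{Z}_p((x))$, and the assertion is understood there. *)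

theory Defs
  imports
    "HOL-Algebra.QuotRing"
    "HOL-Algebra.IntRing"
    "HOL-Algebra.Generated_Rings"
    "HOL-Computational_Algebra.Formal_Power_Series"
begin

section \<open>The \<open>p\<close>-adic completion of a ring\<close>

definition p_power_ideal :: "('a, 'm) ring_scheme \<Rightarrow> nat \<Rightarrow> nat \<Rightarrow> 'a set" where
  "p_power_ideal R p k = PIdl\<^bsub>R\<^esub> ([(p ^ k)] \<cdot>\<^bsub>R\<^esub> \<one>\<^bsub>R\<^esub>)"

text \<open>
  The completion is the inverse limit of the rings \<open>R / p\<^sup>k R\<close>.  An element is a sequence
  \<open>a\<close> of cosets, \<open>a k\<close> being a coset of \<open>p\<^sup>k R\<close>; the coset \<open>a k\<close> is the image of \<open>a (Suc k)\<close>
  under the projection \<open>R / p\<^sup>k\<^sup>+\<^sup>1 R \<rightarrow> R / p\<^sup>k R\<close>, which sends \<open>C\<close> to \<open>p\<^sup>k R + C\<close>.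
\<close>

definition p_adic_completion :: "('a, 'm) ring_scheme \<Rightarrow> nat \<Rightarrow> (nat \<Rightarrow> 'a set) ring" where
  "p_adic_completion R p =
    \<lparr>carrier = {a. \<forall>k. a k \<in> carrier (R Quot p_power_ideal R p k) \<and>
                       a k = p_power_ideal R p k <+>\<^bsub>R\<^esub> a (Suc k)},
     mult = (\<lambda>a b k. a k \<otimes>\<^bsub>R Quot p_power_ideal R p k\<^esub> b k),
     one = (\<lambda>k. \<one>\<^bsub>R Quot p_power_ideal R p k\<^esub>),
     zero = (\<lambda>k. \<zero>\<^bsub>R Quot p_power_ideal R p k\<^esub>),
     add = (\<lambda>a b k. a k \<oplus>\<^bsub>R Quot p_power_ideal R p k\<^esub> b k)\<rparr>"

definition to_completion :: "('a, 'm) ring_scheme \<Rightarrow> nat \<Rightarrow> 'a \<Rightarrow> nat \<Rightarrow> 'a set" where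
  "to_completion R p x = (\<lambda>k. p_power_ideal R p k +>\<^bsub>R\<^esub> x)"

text \<open>
  For a subring \<open>A\<close> of \<open>R\<close>, the map from the completion of \<open>A\<close> to that of \<open>R\<close> induced by the
  inclusion: in degree \<open>k\<close> it sends \<open>x + p\<^sup>k A\<close> to \<open>x + p\<^sup>k R\<close>.
\<close>

definition completion_map :: "('a, 'm) ring_scheme \<Rightarrow> nat \<Rightarrow> (nat \<Rightarrow> 'a set) \<Rightarrow> nat \<Rightarrow> 'a set" where
  "completion_map R p a = (\<lambda>k. p_power_ideal R p k <+>\<^bsub>R\<^esub> a k)"


section \<open>Formal Laurent series over a ring\<close>

text \<open>The sum in the product is finite, since both supports are bounded below.\<close>

definition laurent_series_ring :: "('a, 'm) ring_scheme \<Rightarrow> (int \<Rightarrow> 'a) ring" where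
  "laurent_series_ring R =
    \<lparr>carrier = {f. (\<forall>k. f k \<in> carrier R) \<and> (\<exists>N. \<forall>k<N. f k = \<zero>\<^bsub>R\<^esub>)},
     mult = (\<lambda>f g k. \<Oplus>\<^bsub>R\<^esub>i\<in>{i. f i \<noteq> \<zero>\<^bsub>R\<^esub> \<and> g (k - i) \<noteq> \<zero>\<^bsub>R\<^esub>}. f i \<otimes>\<^bsub>R\<^esub> g (k - i)),
     one = (\<lambda>k. if k = 0 then \<one>\<^bsub>R\<^esub> else \<zero>\<^bsub>R\<^esub>),
     zero = (\<lambda>k. \<zero>\<^bsub>R\<^esub>),
     add = (\<lambda>f g k. f k \<oplus>\<^bsub>R\<^esub> g k)\<rparr>"

definition laurent_const :: "('a, 'm) ring_scheme \<Rightarrow> 'a \<Rightarrow> int \<Rightarrow> 'a" where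
  "laurent_const R c = (\<lambda>k. if k = 0 then c else \<zero>\<^bsub>R\<^esub>)"

definition laurent_X :: "('a, 'm) ring_scheme \<Rightarrow> int \<Rightarrow> 'a" where
  "laurent_X R = (\<lambda>k. if k = 1 then \<one>\<^bsub>R\<^esub> else \<zero>\<^bsub>R\<^esub>)"


section \<open>The \<open>p\<close>-adic integers\<close>

type_synonym padic = "nat \<Rightarrow> int set"

definition Zp :: "nat \<Rightarrow> padic ring" where
  "Zp p = p_adic_completion \<Z> p"

text \<open>
  Meaningful only for rationals whose reduced denominator is prime to \<open>p\<close>, hence a unit
  of \<open>Zp p\<close>.
\<close>

definition Zp_of_rat :: "nat \<Rightarrow> rat \<Rightarrow> padic" where
  "Zp_of_rat p q =
    ([fst (quotient_of q)] \<cdot>\<^bsub>Zp p\<^esub> \<one>\<^bsub>Zp p\<^esub>) \<otimes>\<^bsub>Zp p\<^esub>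
      inv\<^bsub>Zp p\<^esub> ([snd (quotient_of q)] \<cdot>\<^bsub>Zp p\<^esub> \<one>\<^bsub>Zp p\<^esub>)"

definition Zp_laurent :: "nat \<Rightarrow> (int \<Rightarrow> padic) ring" where
  "Zp_laurent p = laurent_series_ring (Zp p)"

definition Zp_laurent_of_fps :: "nat \<Rightarrow> rat fps \<Rightarrow> int \<Rightarrow> padic" where
  "Zp_laurent_of_fps p f = (\<lambda>k. if k < 0 then \<zero>\<^bsub>Zp p\<^esub> else Zp_of_rat p (fps_nth f (nat k)))"


section \<open>The hypergeometric series\<close>

definition hyp_F :: "nat \<Rightarrow> rat fps" where
  "hyp_F n = Abs_fps (\<lambda>r. (\<Prod>j=1..n. pochhammer (of_nat j / of_nat (n + 1)) r) / fact r ^ n)"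

definition hyp_H :: "nat \<Rightarrow> nat \<Rightarrow> rat fps" where
  "hyp_H n p = fps_cutoff p (hyp_F n)"

text \<open>\<open>f\<^sub>i = F\<^sub>i / F\<close>, the quotient being taken over \<open>\<int>\<^sub>p\<close>, where \<open>F\<close> is a unit because \<open>F(0) = 1\<close>.\<close>

definition hyp_f :: "nat \<Rightarrow> nat \<Rightarrow> nat \<Rightarrow> int \<Rightarrow> padic" where
  "hyp_f n p i =
    Zp_laurent_of_fps p ((fps_deriv ^^ i) (hyp_F n)) \<otimes>\<^bsub>Zp_laurent p\<^esub>
      inv\<^bsub>Zp_laurent p\<^esub> Zp_laurent_of_fps p (hyp_F n)"

text \<open>
  The ring \<open>\<int>\<^sub>p[x, (x(1-x)H(x))\<^sup>-\<^sup>1]\<close>, as the subring of \<open>\<int>\<^sub>p((x))\<close> generated by \<open>\<int>\<^sub>p\<close>, \<open>x\<close> and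
  the inverse of \<open>x(1-x)H(x)\<close>, which is a unit of \<open>\<int>\<^sub>p((x))\<close> because \<open>H(0) = 1\<close>.
\<close>

definition hyp_ring :: "nat \<Rightarrow> nat \<Rightarrow> (int \<Rightarrow> padic) ring" where
  "hyp_ring n p = (Zp_laurent p)
    \<lparr>carrier := generate_ring (Zp_laurent p)
       (laurent_const (Zp p) ` carrier (Zp p) \<union>
        {laurent_X (Zp p),
         inv\<^bsub>Zp_laurent p\<^esub> Zp_laurent_of_fps p (fps_X * (1 - fps_X) * hyp_H n p)})\<rparr>"


section \<open>The completions and Laurent series rings are commutative rings\<close>

lemma p_power_ideal_ideal:
  fixes R (structure) assumes "cring R" shows "ideal (p_power_ideal R p k) R"
proof -
  interpret cring R by fact
  show ?thesis unfolding p_power_ideal_def by (rule cgenideal_ideal) simp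
qed

lemma p_power_ideal_Suc:
  fixes R (structure) assumes "cring R" shows "p_power_ideal R p (Suc k) \<subseteq> p_power_ideal R p k"
proof -
  interpret cring R by fact
  have *: "[(p ^ Suc k)] \<cdot> \<one> = ([p] \<cdot> \<one>) \<otimes> ([(p ^ k)] \<cdot> \<one>)"
    by (simp add: add_pow_ldistr add.nat_pow_pow mult.commute)
  show ?thesis
    unfolding p_power_ideal_def cgenideal_def * by (auto simp: m_assoc[symmetric])
qed

lemma proj_coset:
  fixes R (structure) assumes "cring R" "x \<in> carrier R"
  shows "p_power_ideal R p k <+>\<^bsub>R\<^esub> (p_power_ideal R p (Suc k) +>\<^bsub>R\<^esub> x) = p_power_ideal R p k +>\<^bsub>R\<^esub> x"
proof -
  interpret cring R by fact
  interpret I: ideal "p_power_ideal R p k" R by (rule p_power_ideal_ideal) fact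
  interpret J: ideal "p_power_ideal R p (Suc k)" R by (rule p_power_ideal_ideal) fact
  note s = p_power_ideal_Suc[OF assms(1), of p k]
  show ?thesis
  proof (intro equalityI subsetI)
    fix y assume "y \<in> p_power_ideal R p k <+>\<^bsub>R\<^esub> (p_power_ideal R p (Suc k) +> x)"
    then obtain a b where ab: "a \<in> p_power_ideal R p k" "b \<in> p_power_ideal R p (Suc k)" "y = a \<oplus> (b \<oplus> x)"
      by (auto simp: set_add_def' a_r_coset_def')
    then have "y = (a \<oplus> b) \<oplus> x" using assms I.a_Hcarr J.a_Hcarr by (simp add: a_assoc)
    moreover have "a \<oplus> b \<in> p_power_ideal R p k" using ab s by (intro I.a_closed) auto
    ultimately show "y \<in> p_power_ideal R p k +> x" by (auto simp: a_r_coset_def')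
  next
    fix y assume "y \<in> p_power_ideal R p k +> x"
    then obtain a where ab: "a \<in> p_power_ideal R p k" "y = a \<oplus> x" by (auto simp: a_r_coset_def')
    have "x \<in> p_power_ideal R p (Suc k) +> x" using assms by (intro J.a_rcos_self)
    then show "y \<in> p_power_ideal R p k <+>\<^bsub>R\<^esub> (p_power_ideal R p (Suc k) +> x)"
      using ab by (auto simp: set_add_def')
  qed
qed

lemma cring_p_adic_completion:
  fixes R (structure) assumes "cring R" shows "cring (p_adic_completion R p)"
proof -
  interpret cring R by fact
  define P where "P = p_power_ideal R p"
  define Q where "Q = (\<lambda>k. R Quot P k)"
  have I: "ideal (P k) R" for k unfolding P_def by (rule p_power_ideal_ideal) fact
  have cQ: "cring (Q k)" for k unfolding Q_def by (rule ideal.quotient_is_cring[OF I]) fact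
  have QE: "\<exists>x\<in>carrier R. c = P k +> x" if "c \<in> carrier (Q k)" for c k
    using that by (auto simp: Q_def FactRing_def A_RCOSETS_def')
  have Qc: "P k +> x \<in> carrier (Q k)" if "x \<in> carrier R" for x k
    using that by (auto simp: Q_def FactRing_def A_RCOSETS_def')
  have Qm: "(P k +> x) \<otimes>\<^bsub>Q k\<^esub> (P k +> y) = P k +> (x \<otimes> y)" if "x \<in> carrier R" "y \<in> carrier R" for x y k
    using ideal.rcoset_mult_add[OF I that] by (simp add: Q_def FactRing_def)
  have Qa: "(P k +> x) \<oplus>\<^bsub>Q k\<^esub> (P k +> y) = P k +> (x \<oplus> y)" if "x \<in> carrier R" "y \<in> carrier R" for x y k
    using abelian_subgroup.a_rcos_sum[OF ideal.axioms(1)[OF I, THEN abelian_subgroupI3] that] abelian_group_axioms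
    by (simp add: Q_def FactRing_def)
  have proj: "P k <+>\<^bsub>R\<^esub> (P (Suc k) +> x) = P k +> x" if "x \<in> carrier R" for x k
    unfolding P_def by (rule proj_coset) fact+
  have Q1: "\<one>\<^bsub>Q k\<^esub> = P k +> \<one>" for k by (simp add: Q_def FactRing_def)
  have Q0: "\<zero>\<^bsub>Q k\<^esub> = P k +> \<zero>" for k
    using additive_subgroup.a_subset[OF ideal.axioms(1)[OF I]] by (simp add: Q_def FactRing_def)
  define pr where "pr = (\<lambda>k C. P k <+>\<^bsub>R\<^esub> C)"
  have prm: "pr k (c \<otimes>\<^bsub>Q (Suc k)\<^esub> d) = pr k c \<otimes>\<^bsub>Q k\<^esub> pr k d" 
    and pra: "pr k (c \<oplus>\<^bsub>Q (Suc k)\<^esub> d) = pr k c \<oplus>\<^bsub>Q k\<^esub> pr k d"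
    if "c \<in> carrier (Q (Suc k))" "d \<in> carrier (Q (Suc k))" for c d k
  proof -
    from QE[OF that(1)] QE[OF that(2)] obtain x y where "x \<in> carrier R" "y \<in> carrier R"
      "c = P (Suc k) +> x" "d = P (Suc k) +> y" by blast
    then show "pr k (c \<otimes>\<^bsub>Q (Suc k)\<^esub> d) = pr k c \<otimes>\<^bsub>Q k\<^esub> pr k d" 
     "pr k (c \<oplus>\<^bsub>Q (Suc k)\<^esub> d) = pr k c \<oplus>\<^bsub>Q k\<^esub> pr k d"
      by (simp_all add: Qm Qa proj pr_def)
  qed
  define C where "C = p_adic_completion R p"
  have eq: "pr k (a (Suc k)) = a k \<longleftrightarrow> a k = pr k (a (Suc k))" for a k
    by (rule eq_commute)
  have carr: "carrier C = {a. \<forall>k. a k \<in> carrier (Q k) \<and> pr k (a (Suc k)) = a k}"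
    unfolding eq by (simp add: C_def p_adic_completion_def Q_def P_def pr_def)
  have pr1: "pr k \<one>\<^bsub>Q (Suc k)\<^esub> = \<one>\<^bsub>Q k\<^esub>" "pr k \<zero>\<^bsub>Q (Suc k)\<^esub> = \<zero>\<^bsub>Q k\<^esub>" for k
    unfolding Q1 Q0 by (simp_all add: proj pr_def)
  have ops: "a \<otimes>\<^bsub>C\<^esub> b = (\<lambda>k. a k \<otimes>\<^bsub>Q k\<^esub> b k)" "a \<oplus>\<^bsub>C\<^esub> b = (\<lambda>k. a k \<oplus>\<^bsub>Q k\<^esub> b k)"
    "\<one>\<^bsub>C\<^esub> = (\<lambda>k. \<one>\<^bsub>Q k\<^esub>)" "\<zero>\<^bsub>C\<^esub> = (\<lambda>k. \<zero>\<^bsub>Q k\<^esub>)" for a b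
    by (simp_all add: C_def p_adic_completion_def Q_def P_def)
  note rQ = cring.axioms(1)[OF cQ]
  note QS = ring.ring_simprules[OF rQ] cring.cring_simprules[OF cQ]
  have cc: "a k \<in> carrier (Q k)" "pr k (a (Suc k)) = a k" if "a \<in> carrier C" for a k
    using that by (auto simp: carr)
  have "cring C"
  proof (rule cringI)
    show "abelian_group C"
    proof (rule abelian_groupI)
      fix x assume x: "x \<in> carrier C"
      have inv: "pr k (\<ominus>\<^bsub>Q (Suc k)\<^esub> x (Suc k)) = \<ominus>\<^bsub>Q k\<^esub> x k" for k
      proof -
        have "pr k (\<ominus>\<^bsub>Q (Suc k)\<^esub> x (Suc k)) \<in> carrier (Q k)"
          using QE[of "\<ominus>\<^bsub>Q (Suc k)\<^esub> x (Suc k)" "Suc k"] cc[OF x] Qc by (auto simp: QS pr_def proj)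
        moreover have "pr k (\<ominus>\<^bsub>Q (Suc k)\<^esub> x (Suc k)) \<oplus>\<^bsub>Q k\<^esub> x k = \<zero>\<^bsub>Q k\<^esub>"
          using pra[of "\<ominus>\<^bsub>Q (Suc k)\<^esub> x (Suc k)" k "x (Suc k)"] cc[OF x] pr1 by (simp add: QS)
        ultimately show ?thesis
          using abelian_group.minus_equality[OF ring.is_abelian_group[OF rQ]] cc[OF x] by metis
      qed
      show "\<exists>y\<in>carrier C. y \<oplus>\<^bsub>C\<^esub> x = \<zero>\<^bsub>C\<^esub>"
        by (rule bexI[of _ "\<lambda>k. \<ominus>\<^bsub>Q k\<^esub> x k"]) (use cc[OF x] inv in \<open>auto simp: ops carr QS\<close>)
    qed (auto simp: ops carr QS pra pr1)
    show "comm_monoid C"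
      by (rule comm_monoidI) (auto simp: ops carr QS prm pr1 monoid.r_one[OF ring.is_monoid[OF rQ]])
  qed (auto simp: ops carr QS)
  then show ?thesis by (simp add: C_def)
qed


lemma (in abelian_monoid) finsum_swap:
  assumes "finite A" "finite B" "\<And>i j. i \<in> A \<Longrightarrow> j \<in> B \<Longrightarrow> f i j \<in> carrier G"
  shows "(\<Oplus>i\<in>A. \<Oplus>j\<in>B. f i j) = (\<Oplus>j\<in>B. \<Oplus>i\<in>A. f i j)"
  using assms(1,3)
proof (induction A rule: finite_induct)
  case empty
  then show ?case by simp
next
  case (insert a A)
  have "(\<Oplus>j\<in>B. \<Oplus>i\<in>insert a A. f i j) = (\<Oplus>j\<in>B. f a j \<oplus> (\<Oplus>i\<in>A. f i j))"
    using insert by (intro finsum_cong') (auto intro!: finsum_insert)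
  also have "\<dots> = (\<Oplus>j\<in>B. f a j) \<oplus> (\<Oplus>j\<in>B. \<Oplus>i\<in>A. f i j)"
    using insert.prems by (intro finsum_addf) auto
  also have "\<dots> = (\<Oplus>i\<in>insert a A. \<Oplus>j\<in>B. f i j)"
    using insert by (subst finsum_insert) auto
  finally show ?case by simp
qed

lemma laurent_mult_eq:
  fixes R (structure)
  assumes "cring R" "range f \<subseteq> carrier R" "range g \<subseteq> carrier R" "finite S"
    and "\<And>i. f i \<noteq> \<zero> \<Longrightarrow> g (k - i) \<noteq> \<zero> \<Longrightarrow> i \<in> S"
  shows "(f \<otimes>\<^bsub>laurent_series_ring R\<^esub> g) k = (\<Oplus>i\<in>S. f i \<otimes> g (k - i))"
proof -
  interpret cring R by fact
  have c: "f i \<in> carrier R" "g i \<in> carrier R" for i using assms by auto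
  define A where "A = {i. f i \<noteq> \<zero> \<and> g (k - i) \<noteq> \<zero>}"
  have "(\<Oplus>i\<in>A. f i \<otimes> g (k - i)) = (\<Oplus>i\<in>S. f i \<otimes> g (k - i))"
  proof (rule add.finprod_mono_neutral_cong_left)
    show "f i \<otimes> g (k - i) = \<zero>" if "i \<in> S - A" for i
    proof (cases "f i = \<zero>")
      case True
      then show ?thesis using c(2) by simp
    next
      case False
      then have "g (k - i) = \<zero>" using that by (simp add: A_def)
      then show ?thesis using c(1) by simp
    qed
    show "A \<subseteq> S" unfolding A_def using assms(5) by blast
    show "(\<lambda>i. f i \<otimes> g (k - i)) \<in> S \<rightarrow> carrier R" by (simp add: c)
  qed (use assms(4) in simp_all)
  then show ?thesis by (simp add: laurent_series_ring_def A_def)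
qed

lemma cring_laurent_series_ring:
  fixes R (structure)
  assumes "cring R"
  shows "cring (laurent_series_ring R)"
proof -
  interpret cring R by fact
  define L where "L = laurent_series_ring R"
  have carr: "f \<in> carrier L \<longleftrightarrow> (\<forall>k. f k \<in> carrier R) \<and> (\<exists>N. \<forall>k<N. f k = \<zero>)" for f
    by (simp add: L_def laurent_series_ring_def)
  have ops: "f \<oplus>\<^bsub>L\<^esub> g = (\<lambda>k. f k \<oplus> g k)" "\<one>\<^bsub>L\<^esub> = (\<lambda>k. if k = 0 then \<one> else \<zero>)" "\<zero>\<^bsub>L\<^esub> = (\<lambda>k. \<zero>)" for f g
    by (simp_all add: L_def laurent_series_ring_def)
  have me: "(f \<otimes>\<^bsub>L\<^esub> g) k = (\<Oplus>i\<in>S. f i \<otimes> g (k - i))"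
    if "range f \<subseteq> carrier R" "range g \<subseteq> carrier R" "finite S" 
       "\<And>i. f i \<noteq> \<zero> \<Longrightarrow> g (k - i) \<noteq> \<zero> \<Longrightarrow> i \<in> S" for f g k S
    unfolding L_def using that by (intro laurent_mult_eq assms) auto
  have rg: "range f \<subseteq> carrier R" "f k \<in> carrier R" if "f \<in> carrier L" for f k using that by (auto simp: carr)
  have m: "(f \<otimes>\<^bsub>L\<^esub> g) k = (\<Oplus>i\<in>{N..M}. f i \<otimes> g (k - i))"
    if "f \<in> carrier L" "g \<in> carrier L" "\<And>k. k < N \<Longrightarrow> f k = \<zero>" "\<And>j. j < k - M \<Longrightarrow> g j = \<zero>" for f g k N M
  proof (rule me)
    fix i assume "f i \<noteq> \<zero>" "g (k - i) \<noteq> \<zero>"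
    then have "\<not> i < N" "\<not> k - i < k - M" using that(3)[of i] that(4)[of "k - i"] by blast+
    then show "i \<in> {N..M}" by simp
  qed (use rg(1)[OF that(1)] rg(1)[OF that(2)] in simp_all)
  have mc: "f \<otimes>\<^bsub>L\<^esub> g \<in> carrier L" if fg: "f \<in> carrier L" "g \<in> carrier L" for f g
  proof -
    from fg obtain N M where N: "\<And>k. k < N \<Longrightarrow> f k = \<zero>" and M: "\<And>k. k < M \<Longrightarrow> g k = \<zero>"
      by (auto simp: carr)
    have e: "(f \<otimes>\<^bsub>L\<^esub> g) k = (\<Oplus>i\<in>{N..k-M}. f i \<otimes> g (k - i))" for k
      by (rule m) (use fg N M in auto)
    show ?thesis unfolding carr e
      using rg[OF fg(1)] rg[OF fg(2)] by (auto intro!: exI[of _ "N+M"])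
  qed
  have "cring L"
  proof (rule cringI)
    show "abelian_group L"
    proof (rule abelian_groupI)
      fix x y assume xy: "x \<in> carrier L" "y \<in> carrier L"
      then obtain N M where N: "\<And>k. k < N \<Longrightarrow> x k = \<zero>" and M: "\<And>k. k < M \<Longrightarrow> y k = \<zero>"
        by (auto simp: carr)
      show "x \<oplus>\<^bsub>L\<^esub> y \<in> carrier L"
        using rg[OF xy(1)] rg[OF xy(2)] N M by (auto simp: carr ops intro!: exI[of _ "min N M"])
    next
      fix x assume x: "x \<in> carrier L"
      show "\<exists>y\<in>carrier L. y \<oplus>\<^bsub>L\<^esub> x = \<zero>\<^bsub>L\<^esub>"
        by (rule bexI[of _ "\<lambda>k. \<ominus> x k"]) (use x in \<open>auto simp: ops carr l_neg\<close>)
    qed (auto simp: ops carr a_ac)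
    show "comm_monoid L"
    proof (rule comm_monoidI)
      show "\<one>\<^bsub>L\<^esub> \<in> carrier L" by (auto simp: carr ops intro!: exI[of _ 0])
    next
      fix x y assume xy: "x \<in> carrier L" "y \<in> carrier L"
      then obtain N M where N: "\<And>k. k < N \<Longrightarrow> x k = \<zero>" and M: "\<And>k. k < M \<Longrightarrow> y k = \<zero>"
        by (auto simp: carr)
      show "x \<otimes>\<^bsub>L\<^esub> y = y \<otimes>\<^bsub>L\<^esub> x"
      proof
        fix k
        have "(x \<otimes>\<^bsub>L\<^esub> y) k = (\<Oplus>i\<in>{N..k-M}. x i \<otimes> y (k - i))"
          by (rule m) (use xy N M in auto)
        also have "{N..k-M} = (\<lambda>i. k - i) ` {M..k-N}"
          by (auto simp: image_iff intro!: bexI[of _ "k - _"])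
        also have "(\<Oplus>i\<in>(\<lambda>i. k - i) ` {M..k-N}. x i \<otimes> y (k - i)) = (\<Oplus>i\<in>{M..k-N}. x (k - i) \<otimes> y (k - (k - i)))"
          by (rule finsum_reindex) (use rg[OF xy(1)] rg[OF xy(2)] in \<open>auto simp: inj_on_def\<close>)
        also have "\<dots> = (\<Oplus>i\<in>{M..k-N}. y i \<otimes> x (k - i))"
          by (rule finsum_cong') (use rg[OF xy(1)] rg[OF xy(2)] in \<open>auto simp: m_comm\<close>)
        also have "\<dots> = (y \<otimes>\<^bsub>L\<^esub> x) k"
          by (rule m[symmetric]) (use xy N M in auto)
        finally show "(x \<otimes>\<^bsub>L\<^esub> y) k = (y \<otimes>\<^bsub>L\<^esub> x) k" .
      qed
    next
      fix x assume x: "x \<in> carrier L"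
      show "\<one>\<^bsub>L\<^esub> \<otimes>\<^bsub>L\<^esub> x = x"
      proof
        fix k
        have "(\<one>\<^bsub>L\<^esub> \<otimes>\<^bsub>L\<^esub> x) k = (\<Oplus>i\<in>{0}. \<one>\<^bsub>L\<^esub> i \<otimes> x (k - i))"
          by (rule me) (use rg[OF x] in \<open>auto simp: ops split: if_splits\<close>)
        then show "(\<one>\<^bsub>L\<^esub> \<otimes>\<^bsub>L\<^esub> x) k = x k" using rg[OF x] by (simp add: ops)
      qed
    next
      fix x y z assume xyz: "x \<in> carrier L" "y \<in> carrier L" "z \<in> carrier L"
      then obtain N M P where N: "\<And>k. k < N \<Longrightarrow> x k = \<zero>" and M: "\<And>k. k < M \<Longrightarrow> y k = \<zero>" and P: "\<And>k. k < P \<Longrightarrow> z k = \<zero>"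
        by (auto simp: carr)
      note r = rg[OF xyz(1)] rg[OF xyz(2)] rg[OF xyz(3)] 
      show "x \<otimes>\<^bsub>L\<^esub> y \<otimes>\<^bsub>L\<^esub> z = x \<otimes>\<^bsub>L\<^esub> (y \<otimes>\<^bsub>L\<^esub> z)"
      proof
        fix k
        define S where "S = {N+M..k-P}" define T where "T = {N..k-M-P}"
        have xy0: "(x \<otimes>\<^bsub>L\<^esub> y) j = \<zero>" if "j < N + M" for j
          using m[OF xyz(1,2), of N j "j-M"] N M that by auto
        have yz0: "(y \<otimes>\<^bsub>L\<^esub> z) j = \<zero>" if "j < M + P" for j
          using m[OF xyz(2,3), of M j "j-P"] M P that by auto
        have "(x \<otimes>\<^bsub>L\<^esub> y \<otimes>\<^bsub>L\<^esub> z) k = (\<Oplus>j\<in>S. (x \<otimes>\<^bsub>L\<^esub> y) j \<otimes> z (k - j))"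
          unfolding S_def by (rule m) (use xyz mc xy0 P in auto)
        also have "\<dots> = (\<Oplus>j\<in>S. \<Oplus>i\<in>T. x i \<otimes> y (j - i) \<otimes> z (k - j))"
        proof (rule finsum_cong')
          fix j assume j: "j \<in> S"
          have "(x \<otimes>\<^bsub>L\<^esub> y) j = (\<Oplus>i\<in>T. x i \<otimes> y (j - i))"
            unfolding T_def by (rule m) (use xyz N M j S_def in auto)
          then show "(x \<otimes>\<^bsub>L\<^esub> y) j \<otimes> z (k - j) = (\<Oplus>i\<in>T. x i \<otimes> y (j - i) \<otimes> z (k - j))"
            using r by (simp add: finsum_ldistr T_def)
        qed (use r in auto)
        also have "\<dots> = (\<Oplus>i\<in>T. \<Oplus>j\<in>S. x i \<otimes> y (j - i) \<otimes> z (k - j))"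
          by (rule finsum_swap) (use r S_def T_def in auto)
        also have "\<dots> = (\<Oplus>i\<in>T. x i \<otimes> (y \<otimes>\<^bsub>L\<^esub> z) (k - i))"
        proof (rule finsum_cong')
          fix i assume i: "i \<in> T"
          have "(y \<otimes>\<^bsub>L\<^esub> z) (k - i) = (\<Oplus>j\<in>{N+M-i..k-P-i}. y j \<otimes> z (k - i - j))"
            by (rule m) (use xyz M P i T_def in auto)
          also have "{N+M-i..k-P-i} = (\<lambda>j. j - i) ` S"
            by (auto simp: S_def image_iff intro!: bexI[of _ "_ + i"])
          also have "(\<Oplus>j\<in>(\<lambda>j. j - i) ` S. y j \<otimes> z (k - i - j)) = (\<Oplus>j\<in>S. y (j - i) \<otimes> z (k - i - (j - i)))"
            by (rule finsum_reindex) (use r in \<open>auto simp: inj_on_def\<close>)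
          finally show "(\<Oplus>j\<in>S. x i \<otimes> y (j - i) \<otimes> z (k - j)) = x i \<otimes> (y \<otimes>\<^bsub>L\<^esub> z) (k - i)"
            using r by (simp add: finsum_rdistr S_def m_assoc)
        qed (use rg mc xyz in auto)
        also have "\<dots> = (x \<otimes>\<^bsub>L\<^esub> (y \<otimes>\<^bsub>L\<^esub> z)) k"
          unfolding T_def by (rule m[symmetric]) (use xyz mc N yz0 in auto)
        finally show "(x \<otimes>\<^bsub>L\<^esub> y \<otimes>\<^bsub>L\<^esub> z) k = (x \<otimes>\<^bsub>L\<^esub> (y \<otimes>\<^bsub>L\<^esub> z)) k" .
      qed
    qed (use mc in auto)
  next
    fix x y z assume xyz: "x \<in> carrier L" "y \<in> carrier L" "z \<in> carrier L"
    then obtain N M P where N: "\<And>k. k < N \<Longrightarrow> x k = \<zero>" and M: "\<And>k. k < M \<Longrightarrow> y k = \<zero>" and P: "\<And>k. k < P \<Longrightarrow> z k = \<zero>"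
      by (auto simp: carr)
    note r = rg[OF xyz(1)] rg[OF xyz(2)] rg[OF xyz(3)]
    have s: "x \<oplus>\<^bsub>L\<^esub> y \<in> carrier L" 
        using r N M by (auto simp: carr ops intro!: exI[of _ "min N M"])
    show "(x \<oplus>\<^bsub>L\<^esub> y) \<otimes>\<^bsub>L\<^esub> z = x \<otimes>\<^bsub>L\<^esub> z \<oplus>\<^bsub>L\<^esub> y \<otimes>\<^bsub>L\<^esub> z"
    proof
      fix k
      let ?T = "{min N M..k-P}"
      have "((x \<oplus>\<^bsub>L\<^esub> y) \<otimes>\<^bsub>L\<^esub> z) k = (\<Oplus>i\<in>?T. (x i \<oplus> y i) \<otimes> z (k - i))"
        using m[OF s xyz(3), of "min N M" k "k-P"] N M P by (simp add: ops)
      also have "\<dots> = (\<Oplus>i\<in>?T. x i \<otimes> z (k - i) \<oplus> y i \<otimes> z (k - i))"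
        by (rule finsum_cong') (use r in \<open>auto simp: l_distr\<close>)
      also have "\<dots> = (\<Oplus>i\<in>?T. x i \<otimes> z (k - i)) \<oplus> (\<Oplus>i\<in>?T. y i \<otimes> z (k - i))"
        by (rule finsum_addf) (use r in auto)
      also have "\<dots> = (x \<otimes>\<^bsub>L\<^esub> z \<oplus>\<^bsub>L\<^esub> y \<otimes>\<^bsub>L\<^esub> z) k"
        using m[OF xyz(1,3), of "min N M" k "k-P"] m[OF xyz(2,3), of "min N M" k "k-P"] N M P by (simp add: ops)
      finally show "((x \<oplus>\<^bsub>L\<^esub> y) \<otimes>\<^bsub>L\<^esub> z) k = (x \<otimes>\<^bsub>L\<^esub> z \<oplus>\<^bsub>L\<^esub> y \<otimes>\<^bsub>L\<^esub> z) k" .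
    qed
  qed
  then show ?thesis by (simp add: L_def)
qed

lemma cring_Zp: "cring (Zp p)"
  unfolding Zp_def by (rule cring_p_adic_completion int_is_cring)+

lemma cring_Zp_laurent: "cring (Zp_laurent p)"
  unfolding Zp_laurent_def by (rule cring_laurent_series_ring cring_Zp)+

end

theory Submission
  imports
    Defs
    "HOL-Computational_Algebra.Formal_Laurent_Series"
    "HOL-Number_Theory.Residues"
begin

text \<open>
  Write \<open>F = \<Sum> A r x\<^sup>r\<close>.  The quotient \<open>\<rho> r = A r / A (r div p)\<close> is \<open>p\<close>-integral and \<open>1\<close>-Lipschitz for the
  \<open>p\<close>-adic metric.  Consider, for Lipschitz weights \<open>h\<close>, the series \<open>F\<^sub>h = \<Sum> h r A r x\<^sup>r\<close>; for
  \<open>h r = r (r - 1) \<dots> (r - i + 1)\<close> this is \<open>x\<^sup>i\<close> times the \<open>i\<close>-th derivative of \<open>F\<close>.  By induction on \<open>s\<close>, all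
  quotients \<open>F\<^sub>h / F\<close> are rational functions with denominator a power of \<open>H\<close> modulo \<open>p\<^sup>s\<close>: splitting
  \<open>r = a + p m\<close> and writing \<open>(h \<rho>) (a + p m) = (h \<rho>) a + p \<kappa> m\<close>, where \<open>\<kappa>\<close> (depending on \<open>a\<close>) is Lipschitz again, gives
  \<open>F\<^sub>h / F = F(x\<^sup>p) / F \<cdot> \<Sum>\<^sub>a x\<^sup>a ((h \<rho>) a + p (F\<^sub>\<kappa> / F)(x\<^sup>p))\<close>,
  where the last quotient only matters modulo \<open>p\<^sup>s\<^sup>-\<^sup>1\<close>.  For \<open>h = 1\<close> this shows that \<open>F / F(x\<^sup>p)\<close> is \<open>H\<close> plus \<open>p\<close> times
  a rational function, so that \<open>F(x\<^sup>p) / F\<close> is known modulo \<open>p\<^sup>s\<close> as well.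
\<close>

section \<open>Rationals that are integral at \<open>p\<close>\<close>

text \<open>\<open>pint p k\<close> is \<open>p\<^sup>k \<int>\<^bsub>(p)\<^esub>\<close> as a subset of \<open>\<rat>\<close>.\<close>

definition pint :: "nat \<Rightarrow> nat \<Rightarrow> rat set" where
  "pint p k = {of_nat (p ^ k) * of_int a / of_int b | a b. coprime b (int p)}"

locale p_prime =
  fixes p :: nat
  assumes p_prime: "prime p"
begin

lemma coprime_nonzero: "coprime b (int p) \<Longrightarrow> b \<noteq> 0"
  using p_prime by (auto simp: prime_nat_iff)

lemma p_pos [simp]: "p > 0"
  using p_prime prime_gt_0_nat by auto

lemma pintI: "x = of_nat (p ^ k) * of_int a / of_int b \<Longrightarrow> coprime b (int p) \<Longrightarrow> x \<in> pint p k"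
  by (auto simp: pint_def)

lemma pintE:
  assumes "x \<in> pint p k"
  obtains a b where "x = of_nat (p ^ k) * of_int a / of_int b" "coprime b (int p)" "b \<noteq> 0"
  using assms coprime_nonzero by (auto simp: pint_def)

lemma pint_0 [simp]: "0 \<in> pint p k"
  by (rule pintI[of _ _ 0 1]) auto

lemma pint_of_int [simp]: "of_int a \<in> pint p 0"
  by (rule pintI[of _ _ a 1]) auto

lemma pint_of_nat [simp]: "of_nat a \<in> pint p 0"
  using pint_of_int[of "int a"] by simp

lemma pint_1 [simp]: "1 \<in> pint p 0"
  using pint_of_nat[of 1] by simp

lemma pint_power_p: "of_nat p ^ k \<in> pint p k"
  by (rule pintI[of _ _ 1 1]) auto

lemma pint_of_int_dvd: "int (p ^ k) dvd a \<Longrightarrow> of_int a \<in> pint p k"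
  by (rule pintI[of _ _ "a div int (p ^ k)" 1]) (auto elim!: dvdE)

lemma pint_uminus: "x \<in> pint p k \<Longrightarrow> - x \<in> pint p k"
  by (elim pintE, rule_tac a = "- a" in pintI) auto

lemma pint_add: 
  assumes "x \<in> pint p k" "y \<in> pint p k" shows "x + y \<in> pint p k"
proof -
  from assms obtain a b c d where *: "x = of_nat (p ^ k) * of_int a / of_int b" "coprime b (int p)" "b \<noteq> 0"
    "y = of_nat (p ^ k) * of_int c / of_int d" "coprime d (int p)" "d \<noteq> 0" by (elim pintE)
  show ?thesis
    by (rule pintI[of _ _ "a * d + c * b" "b * d"]) (use * in \<open>auto simp: field_simps\<close>)
qed

lemma pint_diff: "x \<in> pint p k \<Longrightarrow> y \<in> pint p k \<Longrightarrow> x - y \<in> pint p k"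
  using pint_add[of x k "- y"] pint_uminus by simp

lemma pint_mult: 
  assumes "x \<in> pint p k" "y \<in> pint p l" shows "x * y \<in> pint p (k + l)"
proof -
  from assms obtain a b c d where *: "x = of_nat (p ^ k) * of_int a / of_int b" "coprime b (int p)" "b \<noteq> 0"
    "y = of_nat (p ^ l) * of_int c / of_int d" "coprime d (int p)" "d \<noteq> 0" by (elim pintE)
  show ?thesis
    by (rule pintI[of _ _ "a * c" "b * d"]) (use * in \<open>auto simp: field_simps power_add\<close>)
qed

lemma pint_mult0: "x \<in> pint p k \<Longrightarrow> y \<in> pint p 0 \<Longrightarrow> x * y \<in> pint p k"
  "x \<in> pint p 0 \<Longrightarrow> y \<in> pint p k \<Longrightarrow> x * y \<in> pint p k"
  using pint_mult[of x k y 0] pint_mult[of x 0 y k] by auto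

lemma pint_Suc: "x \<in> pint p (Suc k) \<Longrightarrow> x \<in> pint p k"
  by (elim pintE, rule_tac a = "int p * a" in pintI) auto

lemma pint_mono: "x \<in> pint p k \<Longrightarrow> l \<le> k \<Longrightarrow> x \<in> pint p l"
  by (induction k) (auto simp: le_Suc_eq dest: pint_Suc)

lemma pint_sum: "(\<And>i. i \<in> S \<Longrightarrow> f i \<in> pint p k) \<Longrightarrow> sum f S \<in> pint p k"
  by (induction S rule: infinite_finite_induct) (auto intro: pint_add)

lemma pint_prod: "(\<And>i. i \<in> S \<Longrightarrow> f i \<in> pint p 0) \<Longrightarrow> prod f S \<in> pint p 0"
  by (induction S rule: infinite_finite_induct) (auto intro: pint_mult0)

lemma pint_power: "x \<in> pint p 0 \<Longrightarrow> x ^ n \<in> pint p 0"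
  by (induction n) (auto intro: pint_mult0)

lemma pint_cancel_p:
  assumes "of_nat (p ^ k) * x \<in> pint p (k + l)" shows "x \<in> pint p l"
proof -
  from assms obtain a b where *: "of_nat (p ^ k) * x = of_nat (p ^ (k + l)) * of_int a / of_int b" 
    "coprime b (int p)" "b \<noteq> 0" by (elim pintE)
  show ?thesis
    by (rule pintI[of _ _ a b]) (use * p_pos in \<open>auto simp: field_simps power_add simp del: p_pos\<close>)
qed

lemma pint_inverse_of_int: "coprime b (int p) \<Longrightarrow> inverse (of_int b) \<in> pint p 0"
  by (rule pintI[of _ _ 1 b]) (auto simp: field_simps)

lemma pint_inverse_of_nat: "coprime b p \<Longrightarrow> inverse (of_nat b) \<in> pint p 0"
  using pint_inverse_of_int[of "int b"] by simp

text \<open>For \<open>x = a / b\<close>, the numerator of \<open>x ^ p - x\<close> over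
  \<open>b ^ p * b\<close> is \<open>a ^ p * b - a * b ^ p\<close>, and Fermat's little theorem for
  \<open>a\<close> and for \<open>b\<close> makes it divisible by \<open>p\<close>.\<close>

lemma pint_fermat:
  assumes "x \<in> pint p 0" shows "x ^ p - x \<in> pint p 1"
proof -
  from assms obtain a b where *: "x = of_int a / of_int b" "coprime b (int p)" "b \<noteq> 0"
    by (elim pintE) auto
  have fermat: "int p dvd c ^ p - c" for c
  proof (cases "int p dvd c")
    case True
    then show ?thesis using dvd_trans[OF True dvd_power[of p c]] by simp
  next
    case False
    define d where "d = nat (c mod int p)"
    have d: "int d = c mod int p" by (simp add: d_def)
    then have "\<not> p dvd d" using False by (simp add: dvd_mod_iff flip: int_dvd_int_iff)
    then have "[int (d ^ (p - 1)) = int 1] (mod int p)"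
      using fermat_theorem[OF p_prime] cong_int_iff by blast
    moreover have "[int d ^ (p - 1) = c ^ (p - 1)] (mod int p)"
      by (rule cong_pow) (simp add: d cong_def)
    ultimately have "[c ^ (p - 1) = 1] (mod int p)" 
      by (metis cong_sym cong_trans of_nat_1 of_nat_power)
    then have "[c ^ (p - 1) * c = 1 * c] (mod int p)" by (rule cong_scalar_right)
    then show ?thesis using power_minus_mult[of p c] p_pos by (simp add: cong_iff_dvd_diff)
  qed
  have "a ^ p * b - a * b ^ p = (a ^ p - a) * b - a * (b ^ p - b)"
    by (simp add: algebra_simps)
  then have "int p dvd a ^ p * b - a * b ^ p" using fermat by simp
  moreover have "x ^ p - x = of_int (a ^ p * b - a * b ^ p) * inverse (of_int (b ^ p * b))"
    unfolding *(1) using *(3) by (simp add: power_divide field_simps)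
  moreover have "inverse (of_int (b ^ p * b)) \<in> pint p 0"
    using * by (intro pint_inverse_of_int) auto
  ultimately show ?thesis using pint_mult0(1) pint_of_int_dvd[of 1 "a ^ p * b - a * b ^ p"] by simp
qed

subsection \<open>Lipschitz functions\<close>

text \<open>Shifts by \<open>p ^ k\<close> suffice: indices congruent modulo \<open>p ^ k\<close>
  are joined by repeated shifts of this kind. So this is the \<open>1\<close>-Lipschitz condition
  for integral values.\<close>

definition lip :: "(nat \<Rightarrow> rat) \<Rightarrow> bool" where
  "lip h \<longleftrightarrow> (\<forall>r. h r \<in> pint p 0) \<and> (\<forall>r k. h (r + p ^ k) - h r \<in> pint p k)"

lemma lip_const: "c \<in> pint p 0 \<Longrightarrow> lip (\<lambda>_. c)"
  by (auto simp: lip_def)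

lemma lip_of_nat: "lip of_nat"
  by (auto simp: lip_def pint_power_p)

lemma lip_diff: "lip f \<Longrightarrow> lip g \<Longrightarrow> lip (\<lambda>r. f r - g r)"
  unfolding lip_def
proof (intro conjI allI; elim conjE)
  fix r k assume *: "\<forall>r k. f (r + p ^ k) - f r \<in> pint p k" "\<forall>r k. g (r + p ^ k) - g r \<in> pint p k"
  have "f (r + p ^ k) - g (r + p ^ k) - (f r - g r) = (f (r + p ^ k) - f r) - (g (r + p ^ k) - g r)"
    by simp
  then show "f (r + p ^ k) - g (r + p ^ k) - (f r - g r) \<in> pint p k"
    using * pint_diff by metis
qed (auto intro: pint_diff)

lemma lip_mult: "lip f \<Longrightarrow> lip g \<Longrightarrow> lip (\<lambda>r. f r * g r)"
  unfolding lip_def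
proof (intro conjI allI; elim conjE)
  fix r k assume *: "\<forall>r k. f (r + p ^ k) - f r \<in> pint p k" "\<forall>r k. g (r + p ^ k) - g r \<in> pint p k"
    "\<forall>r. f r \<in> pint p 0" "\<forall>r. g r \<in> pint p 0"
  have "f (r + p ^ k) * g (r + p ^ k) - f r * g r = 
    (f (r + p ^ k) - f r) * g (r + p ^ k) + f r * (g (r + p ^ k) - g r)"
    by (simp add: algebra_simps)
  then show "f (r + p ^ k) * g (r + p ^ k) - f r * g r \<in> pint p k"
    using * pint_add pint_mult0 by metis
qed (auto intro: pint_mult0)

lemma lip_power: "lip f \<Longrightarrow> lip (\<lambda>r. f r ^ n)"
  by (induction n) (auto intro: lip_const lip_mult)

lemma lip_prod: "(\<And>i. i \<in> S \<Longrightarrow> lip (f i)) \<Longrightarrow> lip (\<lambda>r. \<Prod>i\<in>S. f i r)"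
  by (induction S rule: infinite_finite_induct) (auto intro: lip_const lip_mult)

lemma lip_inverse: 
  assumes "lip f" "\<And>r. f r \<noteq> 0" "\<And>r. inverse (f r) \<in> pint p 0"
  shows "lip (\<lambda>r. inverse (f r))"
  unfolding lip_def
proof (intro conjI allI)
  fix r k
  have "inverse (f (r + p ^ k)) - inverse (f r) = 
    - ((f (r + p ^ k) - f r) * (inverse (f r) * inverse (f (r + p ^ k))))"
    using assms(2) by (simp add: field_simps)
  moreover have "(f (r + p ^ k) - f r) * (inverse (f r) * inverse (f (r + p ^ k))) \<in> pint p k"
    using assms(1,3) by (intro pint_mult0(1)) (auto simp: lip_def)
  ultimately show "inverse (f (r + p ^ k)) - inverse (f r) \<in> pint p k"
    by (simp add: pint_uminus)
qed (use assms in auto)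

text \<open>Division by \<open>p\<close> costs one power of \<open>p\<close>, but a shift of
  \<open>m\<close> by \<open>p ^ k\<close> moves \<open>a + p * m\<close> by
  \<open>p ^ Suc k\<close>, which makes up for it.\<close>

lemma lip_quotient:
  assumes "lip f"
  shows "lip (\<lambda>m. (f (a + p * m) - f a) / of_nat p)"
proof -
  have 1: "f (a + p * m) - f a \<in> pint p 1" for m
  proof (induction m)
    case (Suc m)
    have "f (a + p * m + p ^ 1) - f (a + p * m) \<in> pint p 1"
      using assms by (simp only: lip_def)
    from pint_add[OF this Suc] show ?case by (simp add: algebra_simps)
  qed simp
  have div: "x / of_nat p \<in> pint p k" if "x \<in> pint p (Suc k)" for x k
    by (rule pint_cancel_p[of 1]) (use that in simp)
  show ?thesis unfolding lip_def
  proof (intro conjI allI)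
    fix m k
    have "f (a + p * m + p ^ Suc k) - f (a + p * m) \<in> pint p (Suc k)"
      using assms by (simp only: lip_def)
    from div[OF this]
    show "(f (a + p * (m + p ^ k)) - f a) / of_nat p - (f (a + p * m) - f a) / of_nat p \<in> pint p k"
      by (simp add: algebra_simps diff_divide_distrib)
  qed (use div 1 in auto)
qed

subsection \<open>Power series\<close>

text \<open>This is \<open>p^k Z_(p)[[x]]\<close>; congruence of series modulo \<open>p^k\<close> is
  written \<open>f - g \<in> Ifps k\<close>.\<close>

definition Ifps :: "nat \<Rightarrow> rat fps set" where
  "Ifps k = {f. \<forall>i. fps_nth f i \<in> pint p k}"

lemma Ifps_0 [simp]: "0 \<in> Ifps k"
  by (auto simp: Ifps_def)

lemma Ifps_1 [simp]: "1 \<in> Ifps 0"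
  by (auto simp: Ifps_def)

lemma Ifps_X [simp]: "fps_X \<in> Ifps 0"
  by (auto simp: Ifps_def fps_X_def)

lemma Ifps_const: "c \<in> pint p k \<Longrightarrow> fps_const c \<in> Ifps k"
  by (auto simp: Ifps_def)

lemma Ifps_add: "f \<in> Ifps k \<Longrightarrow> g \<in> Ifps k \<Longrightarrow> f + g \<in> Ifps k"
  and Ifps_diff: "f \<in> Ifps k \<Longrightarrow> g \<in> Ifps k \<Longrightarrow> f - g \<in> Ifps k"
  and Ifps_uminus: "f \<in> Ifps k \<Longrightarrow> - f \<in> Ifps k"
  by (auto simp: Ifps_def pint_add pint_diff pint_uminus)

lemma Ifps_mult: "f \<in> Ifps k \<Longrightarrow> g \<in> Ifps l \<Longrightarrow> f * g \<in> Ifps (k + l)"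
  by (auto simp: Ifps_def fps_mult_nth intro!: pint_sum pint_mult)

lemma Ifps_mult0: "f \<in> Ifps k \<Longrightarrow> g \<in> Ifps 0 \<Longrightarrow> f * g \<in> Ifps k"
  "f \<in> Ifps 0 \<Longrightarrow> g \<in> Ifps k \<Longrightarrow> f * g \<in> Ifps k"
  using Ifps_mult[of f k g 0] Ifps_mult[of f 0 g k] by auto

lemma Ifps_mono: "f \<in> Ifps k \<Longrightarrow> l \<le> k \<Longrightarrow> f \<in> Ifps l"
  by (auto simp: Ifps_def intro: pint_mono)

lemma Ifps_power: "f \<in> Ifps k \<Longrightarrow> f ^ n \<in> Ifps (k * n)"
proof (induction n)
  case (Suc n)
  then show ?case using Ifps_mult[of f k "f ^ n" "k * n"] by simp
qed simp

lemma Ifps_power0: "f \<in> Ifps 0 \<Longrightarrow> f ^ n \<in> Ifps 0"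
  using Ifps_power[of f 0 n] by simp

lemma Ifps_sum: "(\<And>i. i \<in> S \<Longrightarrow> f i \<in> Ifps k) \<Longrightarrow> sum f S \<in> Ifps k"
  by (induction S rule: infinite_finite_induct) (auto intro: Ifps_add)

lemma Ifps_compose: "f \<in> Ifps k \<Longrightarrow> f oo (fps_X ^ p) \<in> Ifps k"
  by (auto simp: Ifps_def fps_nth_compose_X_power)

text \<open>Constant term \<open>1\<close> makes the recursion for the coefficients of the inverse
  free of divisions.\<close>

lemma Ifps_inverse:
  assumes "f \<in> Ifps 0" "fps_nth f 0 = 1"
  shows "inverse f \<in> Ifps 0"
proof -
  have "fps_nth (inverse f) i \<in> pint p 0" for i
  proof (induction i rule: less_induct)
    case (less i)
    show ?case
    proof (cases "i = 0")
      case False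
      have "(\<Sum>k = 0..i. fps_nth f k * fps_nth (inverse f) (i - k)) = fps_nth (f * inverse f) i"
        by (simp add: fps_mult_nth)
      also have "f * inverse f = 1" using assms by (simp add: inverse_mult_eq_1')
      finally have "fps_nth (inverse f) i = - (\<Sum>k = Suc 0..i. fps_nth f k * fps_nth (inverse f) (i - k))"
        using assms False by (simp add: sum.atLeast_Suc_atMost)
      also have "\<dots> \<in> pint p 0"
        using assms less by (intro pint_uminus pint_sum pint_mult0(1)) (auto simp: Ifps_def)
      finally show ?thesis .
    qed (use assms in simp)
  qed
  then show ?thesis by (simp add: Ifps_def)
qed

section \<open>Polynomials over \<open>Z_(p)\<close> and the Frobenius congruence\<close>

definition ipoly :: "rat fps set" where
  "ipoly = range fps_of_poly \<inter> Ifps 0"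

lemma ipoly_Ifps: "f \<in> ipoly \<Longrightarrow> f \<in> Ifps 0"
  by (auto simp: ipoly_def)

lemma ipoly_mult: "f \<in> ipoly \<Longrightarrow> g \<in> ipoly \<Longrightarrow> f * g \<in> ipoly"
  by (auto simp: ipoly_def Ifps_mult0 simp flip: fps_of_poly_mult)

lemma ipoly_add: "f \<in> ipoly \<Longrightarrow> g \<in> ipoly \<Longrightarrow> f + g \<in> ipoly"
  by (auto simp: ipoly_def Ifps_add simp flip: fps_of_poly_add)

lemma ipoly_uminus: "f \<in> ipoly \<Longrightarrow> - f \<in> ipoly"
  by (auto simp: ipoly_def Ifps_uminus simp flip: fps_of_poly_uminus)

lemma ipoly_diff: "f \<in> ipoly \<Longrightarrow> g \<in> ipoly \<Longrightarrow> f - g \<in> ipoly"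
  by (auto simp: ipoly_def Ifps_diff simp flip: fps_of_poly_diff)

lemma ipoly_const: "c \<in> pint p 0 \<Longrightarrow> fps_const c \<in> ipoly"
  using Ifps_const[of c 0] by (auto simp: ipoly_def intro!: range_eqI[of _ _ "[:c:]"] fps_of_poly_const[symmetric])

lemma ipoly_1 [simp]: "1 \<in> ipoly"
  using ipoly_const[of 1] by simp

lemma ipoly_0 [simp]: "0 \<in> ipoly"
  using ipoly_const[of 0] by simp

lemma ipoly_X [simp]: "fps_X \<in> ipoly"
  by (auto simp: ipoly_def intro!: range_eqI[of _ _ "[:0, 1:]"])

lemma ipoly_power: "f \<in> ipoly \<Longrightarrow> f ^ n \<in> ipoly"
  by (induction n) (auto intro: ipoly_mult)

lemma ipoly_compose: "f \<in> ipoly \<Longrightarrow> f oo (fps_X ^ p) \<in> ipoly"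
proof -
  assume f: "f \<in> ipoly"
  then obtain P where P: "f = fps_of_poly P" by (auto simp: ipoly_def)
  have "fps_of_poly (pcompose P (monom 1 p)) = f oo (fps_X ^ p)"
    using fps_of_poly_pcompose[of "monom 1 p" P] p_pos by (simp add: P fps_of_poly_monom' coeff_monom)
  then show ?thesis using Ifps_compose[OF ipoly_Ifps[OF f]] by (metis IntI ipoly_def rangeI)
qed

text \<open>Horner's scheme: removing the constant coefficient and dividing by \<open>x\<close>
  keeps the polynomial integral.\<close>

lemma ipoly_induct [consumes 1, case_names const mult_X]:
  assumes "f \<in> ipoly"
    and "\<And>c. c \<in> pint p 0 \<Longrightarrow> Q (fps_const c)"
    and "\<And>c f. c \<in> pint p 0 \<Longrightarrow> f \<in> ipoly \<Longrightarrow> Q f \<Longrightarrow> Q (fps_const c + fps_X * f)"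
  shows "Q f"
proof -
  from assms(1) obtain P where P: "f = fps_of_poly P" "fps_of_poly P \<in> Ifps 0" by (auto simp: ipoly_def)
  from P(2) have "Q (fps_of_poly P)"
  proof (induction P)
    case 0
    show ?case using assms(2)[of 0] by simp
  next
    case (pCons a P)
    have "coeff P i \<in> pint p 0" for i
      using pCons.prems by (auto simp: Ifps_def dest!: spec[of _ "Suc i"])
    then have "fps_of_poly P \<in> Ifps 0" by (simp add: Ifps_def)
    moreover from this have "fps_of_poly P \<in> ipoly" by (simp add: ipoly_def)
    moreover have "a \<in> pint p 0" using pCons.prems by (auto simp: Ifps_def dest!: spec[of _ 0])
    ultimately show ?case using pCons.IH assms(3)[of a "fps_of_poly P"] by (simp add: fps_of_poly_pCons mult.commute)
  qed
  then show ?thesis by (simp add: P)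
qed

text \<open>The prime \<open>p\<close> divides \<open>p choose k\<close> for
  \<open>0 < k < p\<close>, so only the two extreme terms survive modulo \<open>p\<close>.\<close>

lemma freshmans_dream:
  assumes "f \<in> Ifps 0" "g \<in> Ifps 0"
  shows "(f + g) ^ p - (f ^ p + g ^ p) \<in> Ifps 1"
proof -
  have "(f + g) ^ p = (\<Sum>k\<le>p. of_nat (p choose k) * f ^ k * g ^ (p - k))"
    by (rule binomial_ring)
  also have "{..p} = insert 0 (insert p {0<..<p})" by auto
  also have "(\<Sum>k\<in>\<dots>. of_nat (p choose k) * f ^ k * g ^ (p - k)) 
     = g ^ p + f ^ p + (\<Sum>k\<in>{0<..<p}. of_nat (p choose k) * f ^ k * g ^ (p - k))"
    using p_pos by simp
  finally have eq: "(f + g) ^ p - (f ^ p + g ^ p) = (\<Sum>k\<in>{0<..<p}. of_nat (p choose k) * f ^ k * g ^ (p - k))"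
    by simp
  show ?thesis unfolding eq
  proof (intro Ifps_sum Ifps_mult0(1))
    fix k assume "k \<in> {0<..<p}"
    then have "p dvd (p choose k)" using p_prime by (intro dvd_choose_prime) auto
    then have "(of_nat (p choose k) :: rat) \<in> pint p 1"
      using pint_of_int_dvd[of 1 "int (p choose k)"] by simp
    then show "of_nat (p choose k) \<in> Ifps 1" using Ifps_const by (simp flip: fps_of_nat)
  qed (use assms in \<open>auto intro: Ifps_power0\<close>)
qed

text \<open>On constants this is Fermat's congruence; it passes along Horner's scheme because
  \<open>p\<close>-th powers are additive modulo \<open>p\<close>. It is what allows
  \<open>H(x^p)\<close> to be inverted later.\<close>

lemma ipoly_frobenius:
  assumes "f \<in> ipoly"
  shows "(f oo (fps_X ^ p)) - f ^ p \<in> Ifps 1"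
  using assms
proof (induction rule: ipoly_induct)
  case (const c)
  then show ?case using Ifps_uminus[OF Ifps_const[OF pint_fermat[OF const]]]
    by (simp add: fps_const_power flip: fps_const_sub)
next
  case (mult_X c f)
  have X0: "fps_nth (fps_X ^ p :: rat fps) 0 = 0" using p_pos by (simp add: fps_X_power_nth)
  have "((fps_const c + fps_X * f) oo (fps_X ^ p)) = fps_const c + fps_X ^ p * (f oo (fps_X ^ p))"
    using X0 by (simp add: fps_compose_add_distrib fps_compose_mult_distrib)
  \<comment> \<open>The three errors come from the induction hypothesis, from Fermat's congruence
    for \<open>c\<close>, and from the freshman's dream.\<close>
  then have "((fps_const c + fps_X * f) oo (fps_X ^ p)) - (fps_const c + fps_X * f) ^ p =
     fps_X ^ p * ((f oo (fps_X ^ p)) - f ^ p) - (fps_const (c ^ p - c))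
     - ((fps_const c + fps_X * f) ^ p - (fps_const c ^ p + (fps_X * f) ^ p))"
    by (simp add: algebra_simps fps_const_power power_mult_distrib flip: fps_const_sub)
  also have "\<dots> \<in> Ifps 1"
    by (intro Ifps_diff Ifps_mult0(2) mult_X.IH Ifps_const pint_fermat freshmans_dream Ifps_power0)
      (use mult_X in \<open>auto intro: Ifps_const ipoly_Ifps Ifps_mult0\<close>)
  finally show ?case .
qed

end

section \<open>Quotients of weighted series\<close>

text \<open>This holds all that the induction uses about the coefficients. Since
  \<open>\<rho>\<close> enters as a factor and not as a quotient, \<open>A\<close> may
  vanish.\<close>

locale dwork_sequence = p_prime +
  fixes A \<rho> :: "nat \<Rightarrow> rat"
  assumes A_0: "A 0 = 1" and A_rec: "A r = \<rho> r * A (r div p)" and lip_rho: "lip \<rho>"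
begin

lemma A_pint: "A r \<in> pint p 0"
proof (induction r rule: less_induct)
  case (less r)
  show ?case
  proof (cases "r = 0")
    case False
    then have "r div p < r" using prime_gt_1_nat[OF p_prime] by simp
    then show ?thesis using A_rec[of r] less lip_rho by (auto simp: lip_def intro: pint_mult0)
  qed (simp add: A_0)
qed

lemma A_digit: "a < p \<Longrightarrow> A (a + p * m) = \<rho> (a + p * m) * A m"
  using A_rec[of "a + p * m"] by simp

lemma A_eq_rho: "a < p \<Longrightarrow> A a = \<rho> a"
  using A_digit[of a 0] by (simp add: A_0)

definition F :: "rat fps" where "F = Abs_fps A"

definition H :: "rat fps" where "H = fps_cutoff p F"

definition weighted :: "(nat \<Rightarrow> rat) \<Rightarrow> rat fps" where "weighted h = Abs_fps (\<lambda>r. h r * A r)"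

lemma F_0 [simp]: "fps_nth F 0 = 1"
  by (simp add: F_def A_0)

lemma F_Ifps [simp]: "F \<in> Ifps 0"
  by (simp add: F_def Ifps_def A_pint)

lemma H_0 [simp]: "fps_nth H 0 = 1"
  by (simp add: H_def)

lemma H_ipoly [simp]: "H \<in> ipoly"
proof -
  have "H \<in> range fps_of_poly" unfolding H_def by (metis fps_of_poly_truncate rangeI)
  moreover have "H \<in> Ifps 0" by (simp add: H_def F_def Ifps_def A_pint)
  ultimately show ?thesis by (simp add: ipoly_def)
qed

lemma H_Ifps [simp]: "H \<in> Ifps 0"
  by (rule ipoly_Ifps) simp

lemma weighted_Ifps: "lip h \<Longrightarrow> weighted h \<in> Ifps 0"
  by (auto simp: weighted_def Ifps_def lip_def intro: pint_mult0 A_pint)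

lemma weighted_1: "weighted (\<lambda>_. 1) = F"
  by (simp add: weighted_def F_def)

lemma weighted_linear: "weighted (\<lambda>r. c + d * h r) = fps_const c * F + fps_const d * weighted h"
  by (simp add: weighted_def F_def fps_eq_iff algebra_simps)

text \<open>Exponents are sorted by their residue \<open>a\<close> modulo \<open>p\<close>. In
  \<open>A (a + p * m) = \<rho> (a + p * m) * A m\<close> the first factor joins the weight, which
  leaves a weighted series in \<open>x^p\<close>.\<close>

lemma weighted_split: "weighted h = (\<Sum>a<p. fps_X ^ a * (weighted (\<lambda>m. h (a + p * m) * \<rho> (a + p * m)) oo fps_X ^ p))"
proof (rule fps_ext)
  fix k
  let ?g = "\<lambda>m a. h (a + p * m) * \<rho> (a + p * m) * A m"
  have "fps_nth (fps_X ^ a * (weighted (\<lambda>m. h (a + p * m) * \<rho> (a + p * m)) oo fps_X ^ p)) k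
    = (if a = k mod p then h k * A k else 0)" if "a < p" for a
  proof (cases "a \<le> k \<and> p dvd k - a")
    case True
    then obtain m where m: "k = a + p * m" by (metis dvdE le_add_diff_inverse)
    then show ?thesis using that p_pos
      by (simp add: fps_X_power_mult_nth fps_nth_compose_X_power weighted_def A_digit mult.assoc)
  next
    case False
    then have "a \<noteq> k mod p" by (metis mod_less_eq_dividend dvd_minus_mod)
    with False show ?thesis by (auto simp: fps_X_power_mult_nth fps_nth_compose_X_power)
  qed
  then show "fps_nth (weighted h) k = fps_nth (\<Sum>a<p. fps_X ^ a * (weighted (\<lambda>m. h (a + p * m) * \<rho> (a + p * m)) oo fps_X ^ p)) k"
    using p_pos by (simp add: fps_sum_nth weighted_def)
qed

text \<open>\<open>u\<close> agrees modulo \<open>p\<^sup>s\<close> with an element of \<open>\<int>\<^bsub>(p)\<^esub>[x, 1/H]\<close>.\<close>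

definition rational_mod :: "nat \<Rightarrow> rat fps \<Rightarrow> bool" where
  "rational_mod s u \<longleftrightarrow> (\<exists>m. \<exists>P\<in>ipoly. H ^ m * u - P \<in> Ifps s)"

lemma rational_mod_ipoly: "u \<in> ipoly \<Longrightarrow> rational_mod s u"
  unfolding rational_mod_def by (intro exI[of _ 0] bexI[of _ u]) auto

lemma rational_mod_cong: "rational_mod s u \<Longrightarrow> v - u \<in> Ifps s \<Longrightarrow> rational_mod s v"
  unfolding rational_mod_def
proof (elim exE bexE, intro exI bexI)
  fix m P assume *: "H ^ m * u - P \<in> Ifps s" "v - u \<in> Ifps s"
  have "H ^ m * v - P = H ^ m * (v - u) + (H ^ m * u - P)" by (simp add: algebra_simps)
  also have "\<dots> \<in> Ifps s" by (intro Ifps_add Ifps_mult0(2) Ifps_power0 *) simp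
  finally show "H ^ m * v - P \<in> Ifps s" .
qed

lemma rational_mod_add:
  assumes "rational_mod s u" "rational_mod s v" shows "rational_mod s (u + v)"
proof -
  from assms obtain m P n Q where *: "P \<in> ipoly" "Q \<in> ipoly" "H ^ m * u - P \<in> Ifps s" "H ^ n * v - Q \<in> Ifps s"
    by (auto simp: rational_mod_def)
  have "H ^ (m + n) * (u + v) - (H ^ n * P + H ^ m * Q) = H ^ n * (H ^ m * u - P) + H ^ m * (H ^ n * v - Q)"
    by (simp add: algebra_simps power_add)
  also have "\<dots> \<in> Ifps s" by (intro Ifps_add Ifps_mult0(2) Ifps_power0 *) simp_all
  finally show ?thesis unfolding rational_mod_def using * by (blast intro: ipoly_add ipoly_mult ipoly_power H_ipoly)
qed

text \<open>The error of \<open>u\<close> gets multiplied by \<open>H ^ n * v\<close>, whence the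
  integrality of \<open>v\<close>; the error of \<open>v\<close> gets multiplied by the integral
  polynomial \<open>P\<close>.\<close>

lemma rational_mod_mult:
  assumes "rational_mod s u" "rational_mod s v" "v \<in> Ifps 0" shows "rational_mod s (u * v)"
proof -
  from assms obtain m P n Q where *: "P \<in> ipoly" "Q \<in> ipoly" "H ^ m * u - P \<in> Ifps s" "H ^ n * v - Q \<in> Ifps s"
    by (auto simp: rational_mod_def)
  have "H ^ (m + n) * (u * v) - P * Q = (H ^ m * u - P) * (H ^ n * v) + P * (H ^ n * v - Q)"
    by (simp add: algebra_simps power_add)
  also have "\<dots> \<in> Ifps s"
    by (intro Ifps_add Ifps_mult0(1)[OF *(3)] Ifps_mult0(2)[OF _ *(4)] Ifps_mult0(1) Ifps_power0 assms ipoly_Ifps *) simp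
  finally show ?thesis unfolding rational_mod_def using * by (blast intro: ipoly_mult)
qed

text \<open>Multiplication by \<open>p\<close> improves the precision by one power of
  \<open>p\<close>; this gain drives the induction on \<open>s\<close>.\<close>

lemma rational_mod_p: "rational_mod s u \<Longrightarrow> rational_mod (Suc s) (fps_const (of_nat p) * u)"
proof -
  assume "rational_mod s u"
  then obtain m P where *: "P \<in> ipoly" "H ^ m * u - P \<in> Ifps s" by (auto simp: rational_mod_def)
  have "H ^ m * (fps_const (of_nat p) * u) - fps_const (of_nat p) * P = fps_const (of_nat p) * (H ^ m * u - P)"
    by (simp add: algebra_simps)
  also have "\<dots> \<in> Ifps (Suc s)" using Ifps_mult[OF Ifps_const *(2), of "of_nat p" 1] pint_power_p[of 1] by simp
  finally show ?thesis unfolding rational_mod_def using * by (blast intro: ipoly_mult ipoly_const pint_of_nat)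
qed

lemma rational_mod_power: "rational_mod s u \<Longrightarrow> u \<in> Ifps 0 \<Longrightarrow> rational_mod s (u ^ n)"
  by (induction n) (auto intro: rational_mod_ipoly rational_mod_mult Ifps_power0 simp: power_Suc2 simp del: power_Suc)

lemma rational_mod_sum: "(\<And>i. i \<in> X \<Longrightarrow> rational_mod s (f i)) \<Longrightarrow> rational_mod s (sum f X)"
  by (induction X rule: infinite_finite_induct) (auto intro: rational_mod_ipoly rational_mod_add)

lemma rational_mod_inverse_H: "rational_mod s (inverse H)"
  unfolding rational_mod_def by (intro exI[of _ 1] bexI[of _ 1]) (auto simp: inverse_mult_eq_1')

lemma inverse_H_Ifps: "inverse H \<in> Ifps 0"
  by (intro Ifps_inverse) auto

text \<open>Geometric series: as \<open>p\<close> divides \<open>v\<close>, the terms from the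
  \<open>s\<close>-th on vanish modulo \<open>p^s\<close>. The vanishing constant term of
  \<open>v\<close> makes \<open>1 + v\<close> invertible.\<close>

lemma rational_mod_inverse_1_plus:
  assumes "rational_mod s v" "v \<in> Ifps 1" "fps_nth v 0 = 0"
  shows "rational_mod s (inverse (1 + v))"
proof (rule rational_mod_cong)
  have v0: "v \<in> Ifps 0" using assms(2) by (rule Ifps_mono) simp
  have Tm: "rational_mod s (- v)" 
    using rational_mod_mult[OF assms(1) rational_mod_ipoly[OF ipoly_uminus[OF ipoly_1]] Ifps_uminus[OF Ifps_1]] by simp
  show "rational_mod s (\<Sum>k<s. (- v) ^ k)"
    using Tm v0 by (intro rational_mod_sum rational_mod_power) (auto intro: Ifps_uminus)
  have i: "inverse (1 + v) * (1 + v) = 1" using assms by (intro inverse_mult_eq_1) simp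
  \<comment> \<open>The exact remainder of the truncated series is
    \<open>(- v) ^ s / (1 + v)\<close>.\<close>
  have "inverse (1 + v) - (\<Sum>k<s. (- v) ^ k) = inverse (1 + v) * 1 - inverse (1 + v) * (1 + v) * (\<Sum>k<s. (- v) ^ k)"
    unfolding i by simp
  also have "\<dots> = inverse (1 + v) * (1 - (1 - (- v)) * (\<Sum>k<s. (- v) ^ k))"
    by (simp only: mult.assoc right_diff_distrib) simp
  also have "\<dots> = inverse (1 + v) * (- v) ^ s"
    unfolding one_diff_power_eq[symmetric] by simp
  also have "\<dots> \<in> Ifps s"
    using Ifps_power[OF Ifps_uminus[OF assms(2)], of s] v0 assms(3)
    by (intro Ifps_mult0(2) Ifps_inverse Ifps_add) auto
  finally show "inverse (1 + v) - (\<Sum>k<s. (- v) ^ k) \<in> Ifps s" .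
qed

section \<open>Substitution of \<open>x^p\<close> for \<open>x\<close>\<close>

lemma X_p_0 [simp]: "fps_nth (fps_X ^ p :: rat fps) 0 = 0"
  using p_pos by (simp add: fps_X_power_nth)

lemma compose_nth_0: "fps_nth (u oo (fps_X ^ p)) 0 = fps_nth u 0"
  using p_pos by (simp add: fps_nth_compose_X_power)

text \<open>By the Frobenius congruence \<open>H(x^p) = H^p (1 + v)\<close> with \<open>v\<close>
  divisible by \<open>p\<close>, and the geometric series inverts the second factor.\<close>

lemma rational_mod_inverse_H_compose: "rational_mod s (inverse (H oo fps_X ^ p))"
proof -
  define v where "v = ((H oo fps_X ^ p) - H ^ p) * inverse H ^ p"
  have HH: "H ^ p * inverse H ^ p = 1" by (simp add: inverse_mult_eq_1' flip: power_mult_distrib)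
  have v1: "v \<in> Ifps 1" unfolding v_def
    by (intro Ifps_mult0(1) ipoly_frobenius Ifps_power0 inverse_H_Ifps) simp
  have Tv: "rational_mod s v" unfolding v_def
    by (intro rational_mod_mult rational_mod_ipoly rational_mod_power rational_mod_inverse_H ipoly_diff ipoly_compose ipoly_power inverse_H_Ifps Ifps_power0) simp_all
  have "fps_nth (H oo fps_X ^ p) 0 = 1" "fps_nth (H ^ p) 0 = 1"
    by (simp_all add: compose_nth_0 fps_nth_power_0)
  then have v0: "fps_nth v 0 = 0" by (simp add: v_def)
  have "H oo fps_X ^ p = H ^ p * (1 + v)"
    using HH by (simp add: v_def algebra_simps)
  then have "inverse (H oo fps_X ^ p) = inverse (1 + v) * inverse H ^ p"
    by (simp add: fps_inverse_mult fps_inverse_power)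
  then show ?thesis
    using rational_mod_mult[OF rational_mod_inverse_1_plus[OF Tv v1 v0] rational_mod_power[OF rational_mod_inverse_H inverse_H_Ifps]] 
    by (simp add: Ifps_power0 inverse_H_Ifps)
qed

text \<open>The substitution turns the denominator \<open>H ^ m\<close> into a power of
  \<open>H(x^p)\<close>, whose inverse is again rational with denominator a power of
  \<open>H\<close> modulo \<open>p^s\<close>.\<close>

lemma rational_mod_compose:
  assumes "rational_mod s u" shows "rational_mod s (u oo fps_X ^ p)"
proof -
  from assms obtain m P where *: "P \<in> ipoly" "H ^ m * u - P \<in> Ifps s" by (auto simp: rational_mod_def)
  define G where "G = H oo fps_X ^ p"
  have G0: "fps_nth G 0 = 1" by (simp add: G_def compose_nth_0)
  have GI: "inverse G \<in> Ifps 0" by (intro Ifps_inverse G0) (simp add: G_def Ifps_compose)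
  have "G ^ m * (u oo fps_X ^ p) - (P oo fps_X ^ p) = (H ^ m * u - P) oo fps_X ^ p"
    by (simp add: G_def fps_compose_sub_distrib fps_compose_mult_distrib fps_compose_power)
  also have "\<dots> \<in> Ifps s" using * by (intro Ifps_compose)
  finally have "inverse G ^ m * (G ^ m * (u oo fps_X ^ p) - (P oo fps_X ^ p)) \<in> Ifps s"
    by (intro Ifps_mult0(2) Ifps_power0 GI)
  moreover have "inverse G ^ m * G ^ m = 1" using G0 by (simp add: inverse_mult_eq_1 flip: power_mult_distrib)
  ultimately have "(u oo fps_X ^ p) - inverse G ^ m * (P oo fps_X ^ p) \<in> Ifps s"
    by (simp add: right_diff_distrib flip: mult.assoc)
  moreover have "rational_mod s (inverse G ^ m * (P oo fps_X ^ p))"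
    using rational_mod_inverse_H_compose GI * ipoly_Ifps[OF ipoly_compose[OF *(1)]]
    by (intro rational_mod_mult rational_mod_power rational_mod_ipoly[OF ipoly_compose]) (simp_all add: G_def)
  ultimately show ?thesis by (rule rational_mod_cong[rotated])
qed

section \<open>The induction on the power of \<open>p\<close>\<close>

theorem weighted_quotient_rational_mod: "lip h \<Longrightarrow> rational_mod s (weighted h * inverse F)"
proof (induction s arbitrary: h)
  case 0
  \<comment> \<open>Modulo \<open>p^0\<close> every integral series is congruent to
    \<open>0\<close>.\<close>
  then have "weighted h * inverse F \<in> Ifps 0" by (intro Ifps_mult0 weighted_Ifps Ifps_inverse) auto
  then show ?case by (intro rational_mod_cong[OF rational_mod_ipoly[OF ipoly_0]]) simp
next
  case (Suc s)
  define \<kappa> where "\<kappa> g a m = (g (a + p * m) * \<rho> (a + p * m) - g a * \<rho> a) / of_nat p" for g :: "nat \<Rightarrow> rat" and a m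
  define Fp where "Fp = F oo fps_X ^ p"
  \<comment> \<open>This collects the quotients of the overview taken at \<open>x^p\<close>. It
    always occurs multiplied by \<open>p\<close>, so its value modulo \<open>p^s\<close> is
    enough.\<close>
  define W where "W g = (\<Sum>a<p. fps_X ^ a * ((weighted (\<kappa> g a) * inverse F) oo fps_X ^ p))" for g
  have F1: "inverse F * F = 1" by (simp add: inverse_mult_eq_1)
  have Fp0: "fps_nth Fp 0 = 1" by (simp add: Fp_def compose_nth_0)
  have FpI: "Fp \<in> Ifps 0" by (simp add: Fp_def Ifps_compose)
  have FF: "inverse Fp * Fp = 1" using Fp0 by (simp add: inverse_mult_eq_1)
  have lip_kappa: "lip (\<kappa> g a)" if "lip g" for g a
    using lip_quotient[OF lip_mult[OF that lip_rho], of a] by (simp add: \<kappa>_def[abs_def])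
  have WI: "W g \<in> Ifps 0" if "lip g" for g unfolding W_def
    by (intro Ifps_sum Ifps_mult0 Ifps_compose Ifps_power0 weighted_Ifps lip_kappa that Ifps_inverse) auto
  \<comment> \<open>The induction hypothesis is applied to the new weights
    \<open>\<kappa> g a\<close>, which is why the weight stays arbitrary in the induction.\<close>
  have TW: "rational_mod s (W g)" if "lip g" for g unfolding W_def
    by (intro rational_mod_sum rational_mod_mult rational_mod_power rational_mod_ipoly rational_mod_compose Suc.IH lip_kappa that Ifps_compose Ifps_mult0 weighted_Ifps Ifps_inverse) auto
  \<comment> \<open>The identity of the overview before division by \<open>F\<close>: a polynomial
    plus \<open>p * W g\<close>, all times \<open>F(x^p)\<close>.\<close>
  have decomp: "weighted g = (\<Sum>a<p. fps_X ^ a * fps_const (g a * \<rho> a)) * Fp + fps_const (of_nat p) * W g * Fp" for g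
  proof -
    have "weighted (\<lambda>m. g (a + p * m) * \<rho> (a + p * m)) oo fps_X ^ p =
      fps_const (g a * \<rho> a) * Fp + fps_const (of_nat p) * ((weighted (\<kappa> g a) * inverse F) oo fps_X ^ p) * Fp" for a
    proof -
      have "(\<lambda>m. g (a + p * m) * \<rho> (a + p * m)) = (\<lambda>m. g a * \<rho> a + of_nat p * \<kappa> g a m)"
        using p_pos by (simp add: \<kappa>_def)
      then have "weighted (\<lambda>m. g (a + p * m) * \<rho> (a + p * m)) = 
          fps_const (g a * \<rho> a) * F + fps_const (of_nat p) * (weighted (\<kappa> g a) * inverse F * F)"
        by (simp only: weighted_linear mult.assoc F1) simp
      then show ?thesis
        by (simp add: fps_compose_add_distrib fps_compose_mult_distrib Fp_def mult.assoc del: fps_const_mult)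
    qed
    then show ?thesis
      by (subst weighted_split) (simp add: sum_distrib_right sum_distrib_left sum.distrib W_def algebra_simps del: fps_const_mult)
  qed
  \<comment> \<open>For weight \<open>1\<close> the polynomial part is the truncation of
    \<open>F\<close>, because \<open>\<rho> a = A a\<close> for \<open>a < p\<close>.\<close>
  have "(\<Sum>a<p. fps_X ^ a * fps_const (1 * \<rho> a)) = H"
  proof (rule fps_ext)
    fix k
    have "fps_nth (fps_X ^ a * fps_const (1 * \<rho> a)) k = (if k = a then \<rho> k else 0)" for a
      by simp
    then show "fps_nth (\<Sum>a<p. fps_X ^ a * fps_const (1 * \<rho> a)) k = fps_nth H k"
      by (simp add: H_def F_def fps_sum_nth A_eq_rho)
  qed
  then have F_eq: "F = (H + fps_const (of_nat p) * W (\<lambda>_. 1)) * Fp"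
    using decomp[of "\<lambda>_. 1"] by (simp add: weighted_1 algebra_simps)
  \<comment> \<open>With this \<open>v\<close>, divisible by \<open>p\<close>, one has
    \<open>F / F(x^p) = H (1 + v)\<close>, so the geometric series yields \<open>F(x^p) / F\<close>
    modulo \<open>p ^ Suc s\<close>.\<close>
  define v where "v = fps_const (of_nat p) * W (\<lambda>_. 1) * inverse H"
  have l1: "lip (\<lambda>_. 1)" by (simp add: lip_const)
  have pI: "fps_const (of_nat p) \<in> Ifps 1" using Ifps_const[OF pint_power_p[of 1]] by simp
  have vI: "v \<in> Ifps 1" unfolding v_def
    by (intro Ifps_mult0(1) pI WI l1 inverse_H_Ifps)
  have Tv: "rational_mod (Suc s) v" unfolding v_def
    by (intro rational_mod_mult rational_mod_p TW l1 rational_mod_inverse_H inverse_H_Ifps)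
  have HH: "inverse H * H = 1" by (simp add: inverse_mult_eq_1)
  have F_eq': "F = H * (1 + v) * Fp"
    using HH F_eq by (simp add: v_def algebra_simps)
  \<comment> \<open>\<open>F\<close>, \<open>H\<close> and \<open>F(x^p)\<close> all have constant
    term \<open>1\<close>, so \<open>1 + v\<close> has it too.\<close>
  then have "fps_nth F 0 = fps_nth (H * (1 + v) * Fp) 0" by (rule arg_cong)
  then have v0: "fps_nth v 0 = 0" using Fp0 by simp
  have "inverse F = inverse H * inverse (1 + v) * inverse Fp"
    by (simp add: F_eq' fps_inverse_mult)
  then have FpF: "Fp * inverse F = inverse (1 + v) * inverse H"
    using FF by (metis (no_types, lifting) mult.commute mult.left_commute mult.right_neutral)
  have T_FpF: "rational_mod (Suc s) (Fp * inverse F)"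
    unfolding FpF by (intro rational_mod_mult rational_mod_inverse_1_plus Tv vI v0 rational_mod_inverse_H inverse_H_Ifps)
  have "weighted h * inverse F = ((\<Sum>a<p. fps_X ^ a * fps_const (h a * \<rho> a)) + fps_const (of_nat p) * W h) * (Fp * inverse F)"
    by (subst decomp) (simp add: algebra_simps)
  moreover have "rational_mod (Suc s) (((\<Sum>a<p. fps_X ^ a * fps_const (h a * \<rho> a)) + fps_const (of_nat p) * W h) * (Fp * inverse F))"
    using Suc.prems lip_rho
    by (intro rational_mod_mult T_FpF rational_mod_add rational_mod_sum rational_mod_p TW rational_mod_ipoly[OF ipoly_mult] ipoly_power ipoly_const Ifps_mult0 FpI Ifps_inverse pint_mult0)
      (auto simp: lip_def)
  ultimately show ?case by (simp only:)
qed

end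

section \<open>The hypergeometric coefficients\<close>

context p_prime
begin

text \<open>Up to sign this is the value of Morita's \<open>p\<close>-adic gamma function at
  \<open>r + 1\<close>.\<close>

primrec unit_fact :: "nat \<Rightarrow> nat" where
  "unit_fact 0 = 1"
| "unit_fact (Suc r) = (if p dvd Suc r then 1 else Suc r) * unit_fact r"

lemma coprime_unit_fact: "coprime (unit_fact r) p"
proof (induction r)
  case (Suc r)
  then show ?case using p_prime prime_imp_coprime[of p "Suc r"] by (auto simp: coprime_commute)
qed simp

text \<open>The multiples of \<open>p\<close> up to \<open>r\<close> are \<open>p\<close> times the
  numbers \<open>1, ..., r div p\<close>; the remaining factors make up
  \<open>unit_fact r\<close>.\<close>

lemma fact_eq_unit_fact: "fact r = unit_fact r * p ^ (r div p) * fact (r div p)"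
proof (induction r)
  case (Suc r)
  show ?case
  proof (cases "p dvd Suc r")
    case True
    then have q: "Suc r div p = Suc (r div p)" by (simp add: div_Suc mod_eq_0_iff_dvd)
    with True have "Suc r = p * Suc (r div p)" by (metis dvd_mult_div_cancel)
    then have "fact (Suc r) = p * Suc (r div p) * fact r" by (metis fact_Suc of_nat_id)
    also have "\<dots> = p * Suc (r div p) * (unit_fact r * p ^ (r div p) * fact (r div p))"
      using Suc by simp
    finally show ?thesis unfolding q using True by (simp add: algebra_simps)
  next
    case False
    then have "Suc r div p = r div p" by (simp add: div_Suc mod_eq_0_iff_dvd)
    then show ?thesis using Suc False by (simp add: algebra_simps)
  qed
qed simp

text \<open>Modulo \<open>p ^ k\<close> the factors after \<open>p ^ k\<close> repeat those after
  \<open>0\<close>, and for \<open>k > 0\<close> the same ones are skipped as multiples of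
  \<open>p\<close>.\<close>

lemma unit_fact_add_power: "[unit_fact (r + p ^ k) = unit_fact r * unit_fact (p ^ k)] (mod p ^ k)"
proof (induction r)
  case (Suc r)
  show ?case
  \<comment> \<open>For \<open>k = 0\<close> the shift by \<open>1\<close> changes which factors are
    skipped, but then the modulus is \<open>1\<close>.\<close>
  proof (cases "k = 0")
    case False
    then have d: "p dvd Suc (r + p ^ k) \<longleftrightarrow> p dvd Suc r"
      using dvd_add_left_iff[of p "p ^ k" "Suc r"] by simp
    have "[Suc (r + p ^ k) = Suc r] (mod p ^ k)" by (simp add: cong_def flip: add_Suc)
    then have "[(if p dvd Suc (r + p ^ k) then 1 else Suc (r + p ^ k)) = (if p dvd Suc r then 1 else Suc r)] (mod p ^ k)"
      by (simp add: d)
    from cong_mult[OF this Suc.IH] show ?thesis by (simp add: mult.assoc)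
  qed simp
qed simp

lemma unit_fact_add_mult_power:
  "[unit_fact (r + j * p ^ k) = unit_fact r * unit_fact (p ^ k) ^ j] (mod p ^ k)"
proof (induction j)
  case (Suc j)
  have "[unit_fact (r + j * p ^ k + p ^ k) = unit_fact (r + j * p ^ k) * unit_fact (p ^ k)] (mod p ^ k)"
    by (rule unit_fact_add_power)
  also have "[unit_fact (r + j * p ^ k) * unit_fact (p ^ k) = unit_fact r * unit_fact (p ^ k) ^ j * unit_fact (p ^ k)] (mod p ^ k)"
    by (rule cong_scalar_right) (rule Suc)
  finally show ?case by (simp add: algebra_simps)
qed simp

lemma pint_of_nat_diff: "[a = b] (mod p ^ k) \<Longrightarrow> of_nat a - of_nat b \<in> pint p k"
  using pint_of_int_dvd[of k "int a - int b"] by (simp add: cong_iff_dvd_diff flip: cong_int_iff)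

text \<open>
  Both \<open>unit_fact (N r)\<close> and \<open>unit_fact r ^ N\<close> get multiplied by \<open>unit_fact (p ^ k) ^ N\<close> when \<open>r\<close>
  increases by \<open>p ^ k\<close>; by not evaluating this factor one avoids a special case for \<open>p = 2\<close>.
\<close>

lemma lip_unit_fact_ratio: "lip (\<lambda>r. of_nat (unit_fact (N * r)) * inverse (of_nat (unit_fact r ^ N)))"
  unfolding lip_def
proof (intro conjI allI)
  have i: "inverse (of_nat (unit_fact r ^ N)) \<in> pint p 0" for r
    by (intro pint_inverse_of_nat) (simp add: coprime_unit_fact)
  show "of_nat (unit_fact (N * r)) * inverse (of_nat (unit_fact r ^ N)) \<in> pint p 0" for r
    by (intro pint_mult0 pint_of_nat i)
  fix r k
  define e where "e = unit_fact (p ^ k)"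
  let ?a = "unit_fact (N * (r + p ^ k))" and ?b = "unit_fact (N * r)"
  let ?c = "unit_fact (r + p ^ k) ^ N" and ?d = "unit_fact r ^ N"
  \<comment> \<open>The two fractions are compared by cross multiplication: the factor
    \<open>e ^ N\<close> leaves \<open>?a\<close> and turns \<open>?d\<close> into
    \<open>?c\<close>.\<close>
  have "[?a * ?d = ?b * e ^ N * ?d] (mod p ^ k)"
    using unit_fact_add_mult_power[of "N * r" N k] by (intro cong_scalar_right) (simp add: e_def algebra_simps)
  also have "?b * e ^ N * ?d = ?b * (unit_fact r * e) ^ N" by (simp add: power_mult_distrib)
  also have "[\<dots> = ?b * ?c] (mod p ^ k)"
    unfolding e_def by (intro cong_scalar_left cong_pow cong_sym[OF unit_fact_add_power])
  finally have "of_nat (?a * ?d) - of_nat (?b * ?c) \<in> pint p k" by (rule pint_of_nat_diff)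
  then have "(of_nat (?a * ?d) - of_nat (?b * ?c)) * (inverse (of_nat ?c) * inverse (of_nat ?d)) \<in> pint p k"
    by (intro pint_mult0(1)[of _ k] pint_mult0(1)[of _ 0] i)
  moreover have "?c \<noteq> 0" "?d \<noteq> 0"
    using coprime_unit_fact prime_gt_1_nat[OF p_prime] by (metis coprime_0_left_iff nat_dvd_1_iff_1 nat_neq_iff power_eq_0_iff)+
  ultimately show "of_nat ?a * inverse (of_nat ?c) - of_nat ?b * inverse (of_nat ?d) \<in> pint p k"
    by (simp add: field_simps)
qed

section \<open>Lipschitz continuity of the other factors of the coefficient ratio\<close>

lemma div_add_power_Suc: "(r + p ^ Suc k) div p = r div p + p ^ k"
  using p_pos by simp

text \<open>A shift by \<open>p ^ Suc l\<close> keeps \<open>r mod p\<close>, hence the exponent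
  \<open>?t r\<close> of \<open>p\<close>, but moves \<open>r div p\<close> only by
  \<open>p ^ l\<close>. The missing power of \<open>p\<close> is supplied by \<open>p ^ ?t r\<close>
  if \<open>?t r > 0\<close>; otherwise the product is empty.\<close>

lemma lip_carry_product:
  "lip (\<lambda>r. of_nat p ^ (N * (r mod p) div p) *
            (\<Prod>i\<in>{1..N * (r mod p) div p}. of_nat N * of_nat (r div p) + of_nat i))"
    (is "lip (\<lambda>r. of_nat p ^ ?t r * ?f (?t r) (r div p))")
  unfolding lip_def
proof (intro conjI allI)
  have lip: "lip (?f t)" for t
  proof -
    have "lip (\<lambda>m. of_nat N * of_nat m - (- of_nat i))" for i
      by (intro lip_diff lip_mult lip_of_nat lip_const pint_uminus pint_of_nat)
    then show ?thesis by (intro lip_prod) simp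
  qed
  show 0: "of_nat p ^ ?t r * ?f (?t r) (r div p) \<in> pint p 0" for r
    using lip[of "?t r"] by (intro pint_mult0 pint_power) (simp_all add: lip_def)
  fix r k
  show "of_nat p ^ ?t (r + p ^ k) * ?f (?t (r + p ^ k)) ((r + p ^ k) div p)
      - of_nat p ^ ?t r * ?f (?t r) (r div p) \<in> pint p k"
  proof (cases k)
    case (Suc l)
    have t: "?t (r + p ^ k) = ?t r" by (simp add: Suc)
    have d: "(r + p ^ k) div p = r div p + p ^ l" unfolding Suc by (rule div_add_power_Suc)
    show ?thesis unfolding t d
    proof (cases "?t r = 0")
      case False
      have "of_nat p ^ ?t r * (?f (?t r) (r div p + p ^ l) - ?f (?t r) (r div p)) \<in> pint p (?t r + l)"
        using lip[of "?t r"] by (intro pint_mult pint_power_p) (simp only: lip_def)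
      moreover have "k \<le> ?t r + l" using False Suc by simp
      ultimately have "of_nat p ^ ?t r * (?f (?t r) (r div p + p ^ l) - ?f (?t r) (r div p)) \<in> pint p k"
        by (rule pint_mono)
      then show "of_nat p ^ ?t r * ?f (?t r) (r div p + p ^ l) - of_nat p ^ ?t r * ?f (?t r) (r div p) \<in> pint p k"
        by (simp only: right_diff_distrib)
    qed simp
  qed (use pint_diff[OF 0[of "r + 1"] 0[of r]] in simp)
qed

text \<open>For \<open>k > 0\<close> a shift by \<open>p ^ k\<close> raises the exponent by
  \<open>p ^ k - p ^ (k - 1) = totient (p ^ k)\<close>, so Euler's theorem applies.\<close>

lemma lip_power_diff_div:
  assumes "coprime p N"
  shows "lip (\<lambda>r. of_nat (N ^ (r - r div p)))"
  unfolding lip_def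
proof (intro conjI allI)
  fix r k
  show "of_nat (N ^ (r + p ^ k - (r + p ^ k) div p)) - of_nat (N ^ (r - r div p)) \<in> pint p k"
  proof (cases k)
    case 0
    then show ?thesis by (simp only: pint_diff pint_of_nat)
  next
    case (Suc l)
    have "p ^ k - p ^ l = totient (p ^ k)" 
      unfolding Suc totient_prime_power_Suc[OF p_prime] by (simp add: diff_mult_distrib2 mult.commute)
    moreover have "r div p \<le> r" "p ^ l \<le> p ^ k" 
      using p_pos Suc by (simp_all add: Suc_leI)
    ultimately have e: "r + p ^ k - (r + p ^ k) div p = (r - r div p) + totient (p ^ k)"
      unfolding Suc div_add_power_Suc by arith
    have "[N ^ totient (p ^ k) = 1] (mod p ^ k)"
      using assms by (intro euler_theorem) (simp add: coprime_commute)
    from cong_scalar_left[OF this, of "N ^ (r - r div p)"]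
    show ?thesis unfolding e power_add by (intro pint_of_nat_diff) simp
  qed
qed (simp only: pint_of_nat)

end

section \<open>Closed form of the coefficients\<close>

lemma fact_add_eq_prod: "fact (m + k) = fact m * (\<Prod>i=1..k. of_nat m + of_nat i :: 'a :: {comm_semiring_1, semiring_char_0})"
  by (induction k) (simp_all add: algebra_simps)

text \<open>Gauss multiplication: with \<open>N = n + 1\<close>, the numbers
  \<open>N (j / N + i)\<close> for \<open>1 <= j <= N\<close> and \<open>i < r\<close> run through
  \<open>1, ..., N r\<close>. The symbol for \<open>j = N\<close>, absent from \<open>F\<close>,
  equals \<open>r!\<close>; this turns the exponent \<open>n\<close> in the denominator into
  \<open>n + 1\<close>.\<close>

lemma hyp_F_nth:
  "fps_nth (hyp_F n) r = fact ((n + 1) * r) / (fact r ^ (n + 1) * of_nat (n + 1) ^ ((n + 1) * r))"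
proof (induction r)
  case (Suc r)
  define N where "N = n + 1"
  have "(\<Prod>j=1..n. of_nat j / of_nat N + of_nat r :: rat) = (\<Prod>j=1..n. (of_nat (N * r) + of_nat j) / of_nat N)"
    by (intro prod.cong) (simp_all add: N_def field_simps)
  also have "\<dots> = (\<Prod>j=1..n. of_nat (N * r) + of_nat j) / of_nat N ^ n"
    by (simp add: prod_dividef)
  finally have *: "(\<Prod>j=1..n. of_nat j / of_nat N + of_nat r :: rat) = \<dots>" .
  \<comment> \<open>Of the \<open>N\<close> new factors the last is \<open>N (r + 1)\<close>; the
    others are \<open>N\<close> times the new Pochhammer factors.\<close>
  have "fact (N * Suc r) = fact (N * r) * (\<Prod>i=1..N. of_nat (N * r) + of_nat i :: rat)"
    using fact_add_eq_prod[of "N * r" N] by (simp add: add.commute)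
  also have "(\<Prod>i=1..N. of_nat (N * r) + of_nat i :: rat) = (\<Prod>i=1..n. of_nat (N * r) + of_nat i) * of_nat (N * Suc r)"
    by (simp add: N_def algebra_simps)
  finally have f: "fact (N * Suc r) = fact (N * r) * ((\<Prod>i=1..n. of_nat (N * r) + of_nat i) * of_nat (N * Suc r) :: rat)" .
  have N0: "(of_nat N :: rat) \<noteq> 0" by (simp add: N_def)
  have "fps_nth (hyp_F n) (Suc r) = fps_nth (hyp_F n) r * (\<Prod>j=1..n. of_nat j / of_nat N + of_nat r) / of_nat (Suc r) ^ n"
    by (simp add: hyp_F_def pochhammer_Suc prod.distrib power_mult_distrib N_def)
  also have "\<dots> = fact (N * r) / (fact r ^ N * of_nat N ^ (N * r)) * 
      ((\<Prod>j=1..n. of_nat (N * r) + of_nat j) / of_nat N ^ n) / of_nat (Suc r) ^ n"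
    unfolding * using Suc by (simp only: N_def)
  also have "\<dots> = fact (N * Suc r) / (fact (Suc r) ^ N * of_nat N ^ (N * Suc r))"
  proof -
    have "of_nat (Suc r) ^ N = (of_nat (Suc r) ^ n * of_nat (Suc r) :: rat)"
      "of_nat N ^ (N * Suc r) = (of_nat N ^ n * of_nat N * of_nat N ^ (N * r) :: rat)"
      by (simp_all add: N_def power_add algebra_simps)
    moreover have "fact (Suc r) ^ N = (of_nat (Suc r) ^ N * fact r ^ N :: rat)"
      by (simp add: power_mult_distrib)
    moreover have "(of_nat (Suc r) :: rat) \<noteq> 0" by simp
    ultimately show ?thesis
      unfolding f of_nat_mult using N0 by (simp add: divide_simps del: of_nat_Suc)
  qed
  finally show ?case by (simp only: N_def)
qed (simp add: hyp_F_def)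

locale hypergeometric = p_prime +
  fixes n :: nat
  assumes coprime_p: "coprime p (n + 1)"
begin

text \<open>
  With \<open>m = r div p\<close> and \<open>N = n + 1\<close>, the quotient of the coefficients of \<open>F\<close> at \<open>r\<close> and \<open>m\<close>: there
  are \<open>N (r mod p) div p\<close> multiples of \<open>p\<close> in the interval from \<open>N p m + 1\<close> to \<open>N r\<close>, and they
  contribute the middle factor.
\<close>

definition rho :: "nat \<Rightarrow> rat" where
  "rho r = (of_nat (unit_fact ((n + 1) * r)) * inverse (of_nat (unit_fact r ^ (n + 1)))) *
     (of_nat p ^ ((n + 1) * (r mod p) div p) *
            (\<Prod>i\<in>{1..(n + 1) * (r mod p) div p}. of_nat (n + 1) * of_nat (r div p) + of_nat i)) *
     inverse (of_nat ((n + 1) ^ (r - r div p)) ^ (n + 1))"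

lemma lip_rho: "lip rho"
proof -
  have "coprime (((n + 1) ^ e) ^ (n + 1)) p" for e
    using coprime_p by (simp add: coprime_commute del: power_Suc)
  from pint_inverse_of_nat[OF this]
  show ?thesis unfolding rho_def[abs_def]
    by (intro lip_mult lip_unit_fact_ratio lip_carry_product lip_inverse lip_power lip_power_diff_div coprime_p)
      (simp_all del: power_Suc)
qed

text \<open>The multiples of \<open>p\<close> are split off from all factorials:
  \<open>p ^ (N m + t)\<close> from \<open>(N r)!\<close> against \<open>p ^ (N m)\<close> from
  \<open>r! ^ N\<close> leaves \<open>p ^ t\<close>, and \<open>(N m + t)!\<close> against
  \<open>(N m)!\<close> leaves the product \<open>P\<close>.\<close>

lemma hyp_F_nth_rec: "fps_nth (hyp_F n) r = rho r * fps_nth (hyp_F n) (r div p)"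
proof -
  define N where "N = n + 1"
  define m where "m = r div p"
  define t where "t = N * (r mod p) div p"
  define P where "P = (\<Prod>i=1..t. of_nat (N * m) + of_nat i :: rat)"
  have "N * r = N * (r mod p) + N * m * p"
    by (metis add.commute distrib_left div_mult_mod_eq m_def mult.assoc)
  then have d: "N * r div p = N * m + t"
    using p_pos by (simp add: t_def)
  have "fact (N * r) = (of_nat (fact (N * r)) :: rat)" by simp
  also have "\<dots> = of_nat (unit_fact (N * r)) * of_nat p ^ (N * m + t) * fact (N * m + t)"
    by (subst fact_eq_unit_fact) (simp add: d)
  also have "fact (N * m + t) = fact (N * m) * P" unfolding P_def by (rule fact_add_eq_prod)
  finally have 1: "fact (N * r) = of_nat (unit_fact (N * r)) * of_nat p ^ (N * m + t) * (fact (N * m) * P)" .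
  have "fact r = (of_nat (fact r) :: rat)" by simp
  also have "\<dots> = of_nat (unit_fact r) * of_nat p ^ m * fact m"
    by (subst fact_eq_unit_fact) (simp add: m_def)
  finally have 2: "fact r ^ N = (of_nat (unit_fact r ^ N) * of_nat p ^ (N * m) * fact m ^ N :: rat)"
    by (simp add: power_mult_distrib mult.commute flip: power_mult)
  have "m \<le> r" by (simp add: m_def)
  then have "N * r = N * m + (r - m) * N" by (metis add_mult_distrib2 le_add_diff_inverse mult.commute)
  then have 3: "of_nat N ^ (N * r) = (of_nat N ^ (N * m) * of_nat (N ^ (r - m)) ^ N :: rat)"
    by (simp add: power_add power_mult)
  have r: "rho r = (of_nat (unit_fact (N * r)) * inverse (of_nat (unit_fact r ^ N))) *
     (of_nat p ^ t * P) * inverse (of_nat (N ^ (r - m)) ^ N)"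
    by (simp only: rho_def P_def t_def m_def N_def of_nat_mult)
  show ?thesis
    unfolding hyp_F_nth N_def[symmetric] m_def[symmetric] r 1 2 3
    using p_pos by (simp add: field_simps power_add N_def del: p_pos)
qed

sublocale dwork_sequence p "\<lambda>r. fps_nth (hyp_F n) r" rho
proof
  show "fps_nth (hyp_F n) 0 = 1" by (simp add: hyp_F_nth)
qed (rule hyp_F_nth_rec lip_rho)+

lemma F_eq: "F = hyp_F n"
  by (simp add: F_def fps_eq_iff)

lemma H_eq: "H = hyp_H n p"
  by (simp add: H_def hyp_H_def F_eq)

section \<open>From falling factorial weights to derivatives\<close>

lemma fps_nth_iterated_deriv:
  "fps_nth ((fps_deriv ^^ i) f) k = (\<Prod>j<i. of_nat (k + i) - of_nat j) * fps_nth f (k + i)" for f :: "rat fps"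
proof (induction i arbitrary: k)
  case (Suc i)
  then show ?case by (simp add: algebra_simps)
qed simp

text \<open>With a falling factorial as weight the weighted quotient is \<open>x^i\<close> times
  \<open>F_i / F\<close>. The power \<open>m + i\<close> of \<open>x (1 - x) H\<close> supplies both
  \<open>H ^ m\<close> and this \<open>x^i\<close>; the factors left over form the polynomial
  \<open>V\<close>.\<close>

lemma hyp_quotient_approx:
  "\<exists>m. \<exists>Q\<in>ipoly. (fps_X * (1 - fps_X) * hyp_H n p) ^ m * ((fps_deriv ^^ i) (hyp_F n) * inverse (hyp_F n)) - Q \<in> Ifps s"
proof -
  define h where "h r = (\<Prod>j<i. of_nat r - of_nat j :: rat)" for r
  have "lip h" unfolding h_def[abs_def]
    by (intro lip_prod lip_diff lip_of_nat lip_const pint_of_nat)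
  from weighted_quotient_rational_mod[OF this, of s] obtain m P where P: "P \<in> ipoly" "H ^ m * (weighted h * inverse F) - P \<in> Ifps s"
    unfolding rational_mod_def by blast
  have S: "weighted h = fps_X ^ i * (fps_deriv ^^ i) F"
  proof (rule fps_ext)
    fix k
    show "fps_nth (weighted h) k = fps_nth (fps_X ^ i * (fps_deriv ^^ i) F) k"
    proof (cases "k < i")
      case True
      then have "h k = 0" by (auto simp: h_def)
      then show ?thesis using True by (simp add: weighted_def fps_X_power_mult_nth)
    next
      case False
      then show ?thesis by (simp add: weighted_def fps_X_power_mult_nth fps_nth_iterated_deriv h_def F_def)
    qed
  qed
  define V where "V = (fps_X * (1 - fps_X)) ^ m * ((1 - fps_X) * H) ^ i"
  have V: "V \<in> ipoly" unfolding V_def by (intro ipoly_mult ipoly_power ipoly_diff) simp_all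
  have "(fps_X * (1 - fps_X) * H) ^ (m + i) = V * H ^ m * fps_X ^ i"
    by (simp only: V_def power_add power_mult_distrib mult_ac)
  then have "(fps_X * (1 - fps_X) * H) ^ (m + i) * ((fps_deriv ^^ i) F * inverse F) - V * P =
     V * (H ^ m * (weighted h * inverse F) - P)"
    unfolding S by (simp add: algebra_simps)
  also have "\<dots> \<in> Ifps s" by (intro Ifps_mult0(2) ipoly_Ifps V P)
  finally show ?thesis unfolding F_eq H_eq using ipoly_mult[OF V P(1)] by blast
qed

end

section \<open>Transfer to the \<open>p\<close>-adic completion\<close>

lemma mem_p_power_ideal:
  "x \<in> p_power_ideal R p k \<longleftrightarrow> (\<exists>z\<in>carrier R. x = z \<otimes>\<^bsub>R\<^esub> ([(p ^ k)] \<cdot>\<^bsub>R\<^esub> \<one>\<^bsub>R\<^esub>))"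
  by (auto simp: p_power_ideal_def cgenideal_def)

lemma add_pow_update_carrier: "[(m :: nat)] \<cdot>\<^bsub>R\<lparr>carrier := A\<rparr>\<^esub> x = [m] \<cdot>\<^bsub>R\<^esub> x"
  by (simp add: add_pow_def nat_pow_def)

lemma p_power_coset_add:
  fixes R (structure)
  assumes "cring R" "d \<in> p_power_ideal R p k" "x \<in> carrier R"
  shows "p_power_ideal R p k +> (d \<oplus> x) = p_power_ideal R p k +> x"
proof -
  interpret cring R by fact
  interpret I: ideal "p_power_ideal R p k" R by (rule p_power_ideal_ideal) fact
  have "d \<oplus> x \<in> p_power_ideal R p k +> x" using assms by (auto simp: a_r_coset_def')
  then show ?thesis using assms(3) by (rule I.a_repr_independence'[symmetric])
qed

lemma completion_map_coset:
  fixes R (structure)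
  assumes "cring R" "subring A R" "x \<in> A"
  defines "S \<equiv> R\<lparr>carrier := A\<rparr>"
  shows "p_power_ideal R p k <+>\<^bsub>R\<^esub> (p_power_ideal S p k +>\<^bsub>S\<^esub> x) = p_power_ideal R p k +> x"
proof -
  interpret cring R by fact
  interpret I: ideal "p_power_ideal R p k" R by (rule p_power_ideal_ideal) fact
  note A = subringE[OF assms(2)]
  have sub: "p_power_ideal S p k \<subseteq> p_power_ideal R p k"
    unfolding mem_p_power_ideal subset_iff using A(1) by (auto simp: S_def add_pow_update_carrier)
  have zero: "\<zero> \<in> p_power_ideal S p k"
    using A(2) by (auto simp: mem_p_power_ideal S_def add_pow_update_carrier intro!: bexI[of _ "\<zero>"])
  have S: "p_power_ideal S p k +>\<^bsub>S\<^esub> x = {c \<oplus> x | c. c \<in> p_power_ideal S p k}"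
    by (auto simp: a_r_coset_def' S_def)
  have R: "p_power_ideal R p k +> x = {c \<oplus> x | c. c \<in> p_power_ideal R p k}"
    by (auto simp: a_r_coset_def')
  have x: "x \<in> carrier R" using A(1) assms(3) by auto
  show ?thesis
  proof (intro equalityI subsetI)
    fix y assume "y \<in> p_power_ideal R p k <+>\<^bsub>R\<^esub> (p_power_ideal S p k +>\<^bsub>S\<^esub> x)"
    then obtain a c where ac: "a \<in> p_power_ideal R p k" "c \<in> p_power_ideal S p k" "y = a \<oplus> (c \<oplus> x)"
      unfolding S by (auto simp: set_add_def')
    then have "y = (a \<oplus> c) \<oplus> x" using sub x I.a_Hcarr by (auto simp: a_assoc)
    then show "y \<in> p_power_ideal R p k +> x" unfolding R using ac sub I.a_closed by blast
  next
    fix y assume "y \<in> p_power_ideal R p k +> x"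
    then obtain a where a: "a \<in> p_power_ideal R p k" "y = a \<oplus> x" unfolding R by auto
    have "x = \<zero> \<oplus> x" using x by simp
    then have "x \<in> p_power_ideal S p k +>\<^bsub>S\<^esub> x" unfolding S using zero by blast
    then show "y \<in> p_power_ideal R p k <+>\<^bsub>R\<^esub> (p_power_ideal S p k +>\<^bsub>S\<^esub> x)"
      using a by (auto simp: set_add_def')
  qed
qed

text \<open>The \<open>g k\<close> approximate \<open>f\<close> modulo \<open>p^k R\<close>. Their
  compatibility is required modulo \<open>p^k A\<close>, which can be smaller than the intersection
  of \<open>A\<close> with \<open>p^k R\<close>, because their classes have to form an element of
  the completion of \<open>A\<close>.\<close>

lemma to_completion_in_subring_completion:
  fixes R (structure)
  assumes R: "cring R" and A: "subring A R" and g: "\<And>k. g k \<in> A"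
    and f: "\<And>k. \<exists>d\<in>p_power_ideal R p k. f = d \<oplus> g k"
    and step: "\<And>k. \<exists>d\<in>p_power_ideal (R\<lparr>carrier := A\<rparr>) p k. g (Suc k) = d \<oplus> g k"
  shows "to_completion R p f \<in> completion_map R p ` carrier (p_adic_completion (R\<lparr>carrier := A\<rparr>) p)"
proof (rule image_eqI)
  define S where "S = R\<lparr>carrier := A\<rparr>"
  define a where "a = (\<lambda>k. p_power_ideal S p k +>\<^bsub>S\<^esub> g k)"
  interpret cring R by fact
  have S: "cring S"
    unfolding S_def using subcring_iff[OF subringE(1)[OF A]] subcringI'[OF A] by simp
  have gS: "g k \<in> carrier S" for k using g by (simp add: S_def)
  have gR: "g k \<in> carrier R" for k using g subringE(1)[OF A] by auto
  show "to_completion R p f = completion_map R p a"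
  proof
    fix k
    obtain d where d: "d \<in> p_power_ideal R p k" "f = d \<oplus> g k" using f by blast
    show "to_completion R p f k = completion_map R p a k"
      using completion_map_coset[OF R A g, of p k k] p_power_coset_add[OF R d(1) gR] 
      by (simp add: to_completion_def completion_map_def a_def S_def d(2))
  qed
  have "p_power_ideal S p k <+>\<^bsub>S\<^esub> a (Suc k) = a k" for k
  proof -
    obtain d where d: "d \<in> p_power_ideal S p k" "g (Suc k) = d \<oplus>\<^bsub>S\<^esub> g k" using step by (auto simp: S_def)
    then show ?thesis
      using p_power_coset_add[OF S d(1) gS] proj_coset[OF S gS[of "Suc k"], of p k] by (simp add: a_def)
  qed
  moreover have "a k \<in> carrier (S Quot p_power_ideal S p k)" for k
    using gS by (auto simp: a_def FactRing_def A_RCOSETS_def')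
  ultimately show "a \<in> carrier (p_adic_completion (R\<lparr>carrier := A\<rparr>) p)"
    by (auto simp: p_adic_completion_def simp flip: S_def)
qed

lemma to_completion_of_nat:
  fixes R (structure)
  assumes "cring R"
  shows "[(m :: nat)] \<cdot>\<^bsub>p_adic_completion R p\<^esub> \<one>\<^bsub>p_adic_completion R p\<^esub> = to_completion R p ([m] \<cdot> \<one>)"
proof -
  interpret cring R by fact
  interpret C: cring "p_adic_completion R p" by (rule cring_p_adic_completion) fact
  have I: "ideal (p_power_ideal R p k) R" for k by (rule p_power_ideal_ideal) fact
  show ?thesis
  proof (induction m)
    case 0
    have "[(0 :: nat)] \<cdot>\<^bsub>p_adic_completion R p\<^esub> \<one>\<^bsub>p_adic_completion R p\<^esub> = \<zero>\<^bsub>p_adic_completion R p\<^esub>"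
      by simp
    also have "\<dots> = to_completion R p \<zero>"
      using additive_subgroup.a_subset[OF ideal.axioms(1)[OF I]]
      by (simp add: to_completion_def p_adic_completion_def FactRing_def)
    finally show ?case by simp
  next
    case (Suc m)
    show ?case
    proof
      fix k
      have "to_completion R p ([m] \<cdot> \<one>) k <+>\<^bsub>R\<^esub> to_completion R p \<one> k = to_completion R p ([m] \<cdot> \<one> \<oplus> \<one>) k"
        unfolding to_completion_def
        by (intro abelian_subgroup.a_rcos_sum ideal.axioms(1)[OF I, THEN abelian_subgroupI3] abelian_group_axioms) simp_all
      moreover have "[Suc m] \<cdot>\<^bsub>p_adic_completion R p\<^esub> \<one>\<^bsub>p_adic_completion R p\<^esub> =
          to_completion R p ([m] \<cdot> \<one>) \<oplus>\<^bsub>p_adic_completion R p\<^esub> \<one>\<^bsub>p_adic_completion R p\<^esub>"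
        using Suc by simp
      ultimately show "([Suc m] \<cdot>\<^bsub>p_adic_completion R p\<^esub> \<one>\<^bsub>p_adic_completion R p\<^esub>) k = to_completion R p ([Suc m] \<cdot> \<one>) k"
        by (simp add: p_adic_completion_def FactRing_def to_completion_def)
    qed
  qed
qed

section \<open>Rational numbers in \<open>Z_p\<close>\<close>

context p_prime
begin

interpretation Zp: cring "Zp p" by (rule cring_Zp)

interpretation L: cring "Zp_laurent p" by (rule cring_Zp_laurent)

lemma int_of_nat_Z: "[(m :: nat)] \<cdot>\<^bsub>\<Z>\<^esub> (1 :: int) = int m"
proof (induction m)
  case (Suc m)
  then show ?case by (simp add: add_pow_def nat_pow_def)
qed (simp add: add_pow_def nat_pow_def)

text \<open>Inverses \<open>c k\<close> of \<open>m\<close> exist modulo every \<open>p ^ k\<close>,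
  and uniqueness of inverses makes them a compatible sequence.\<close>

lemma Zp_unit_of_nat:
  assumes "coprime m p"
  shows "[m] \<cdot>\<^bsub>Zp p\<^esub> \<one>\<^bsub>Zp p\<^esub> \<in> Units (Zp p)"
proof -
  interpret Z: cring \<Z> by (rule int_is_cring)
  have "\<exists>c. [int m * c = 1] (mod int (p ^ k))" for k
    using assms by (intro cong_solve_coprime_int) simp
  then obtain c where c: "\<And>k. [int m * c k = 1] (mod int (p ^ k))" by metis
  define P where "P = p_power_ideal \<Z> p"
  have P: "x \<in> P k \<longleftrightarrow> int (p ^ k) dvd x" for x k
    by (auto simp: P_def mem_p_power_ideal int_of_nat_Z dvd_def mult.commute)
  have I: "ideal (P k) \<Z>" for k unfolding P_def by (rule p_power_ideal_ideal) (rule int_is_cring)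
  have eq: "P k +>\<^bsub>\<Z>\<^esub> x = P k +>\<^bsub>\<Z>\<^esub> y" if "[x = y] (mod int (p ^ k))" for x y k
    using p_power_coset_add[OF int_is_cring, of "x - y" p k y] that
    by (simp add: cong_iff_dvd_diff P flip: P_def)
  define j where "j = (\<lambda>k. P k +>\<^bsub>\<Z>\<^esub> c k)"
  have "P k <+>\<^bsub>\<Z>\<^esub> j (Suc k) = j k" for k
  proof -
    have "[int m * c (Suc k) = 1] (mod int (p ^ k))"
      by (rule cong_dvd_modulus[OF c]) simp
    \<comment> \<open>Modulo \<open>p ^ k\<close>, both \<open>c k\<close> and
      \<open>c (Suc k)\<close> agree with the product of \<open>c k\<close>, \<open>m\<close> and
      \<open>c (Suc k)\<close>.\<close>
    then have "[c k * (int m * c (Suc k)) = c k * 1] (mod int (p ^ k))" by (rule cong_scalar_left)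
    moreover have "[c (Suc k) * (int m * c k) = c (Suc k) * 1] (mod int (p ^ k))" 
      by (rule cong_scalar_left) (rule c)
    ultimately have "[c (Suc k) = c k] (mod int (p ^ k))"
      by (metis cong_sym cong_trans mult.commute mult.left_commute mult.right_neutral)
    then show ?thesis
      using proj_coset[OF int_is_cring, of "c (Suc k)" p k] eq by (simp add: j_def flip: P_def)
  qed
  moreover have "j k \<in> carrier (\<Z> Quot P k)" for k
    by (auto simp: FactRing_def A_RCOSETS_def' j_def)
  ultimately have j: "j \<in> carrier (Zp p)"
    by (simp add: Zp_def p_adic_completion_def flip: P_def)
  have "([m] \<cdot>\<^bsub>Zp p\<^esub> \<one>\<^bsub>Zp p\<^esub>) \<otimes>\<^bsub>Zp p\<^esub> j = \<one>\<^bsub>Zp p\<^esub>"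
  proof
    fix k
    have "(([m] \<cdot>\<^bsub>Zp p\<^esub> \<one>\<^bsub>Zp p\<^esub>) \<otimes>\<^bsub>Zp p\<^esub> j) k = P k +>\<^bsub>\<Z>\<^esub> (int m * c k)"
      using ideal.rcoset_mult_add[OF I, of "int m" "c k" k]
      unfolding Zp_def to_completion_of_nat[OF int_is_cring]
      by (simp add: to_completion_def int_of_nat_Z p_adic_completion_def FactRing_def j_def flip: P_def)
    also have "\<dots> = P k +>\<^bsub>\<Z>\<^esub> 1" by (rule eq) (rule c)
    also have "\<dots> = \<one>\<^bsub>Zp p\<^esub> k" by (simp add: Zp_def p_adic_completion_def FactRing_def P_def)
    finally show "(([m] \<cdot>\<^bsub>Zp p\<^esub> \<one>\<^bsub>Zp p\<^esub>) \<otimes>\<^bsub>Zp p\<^esub> j) k = \<one>\<^bsub>Zp p\<^esub> k" .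
  qed
  then show ?thesis using j Zp.m_comm[of j "[m] \<cdot>\<^bsub>Zp p\<^esub> \<one>\<^bsub>Zp p\<^esub>"]
    by (auto simp: Units_def)
qed

abbreviation zp :: "int \<Rightarrow> padic" where "zp z \<equiv> [z] \<cdot>\<^bsub>Zp p\<^esub> \<one>\<^bsub>Zp p\<^esub>"

lemma zp_mult: "zp (a * b) = zp a \<otimes>\<^bsub>Zp p\<^esub> zp b"
  by (simp add: Zp.add_pow_ldistr_int Zp.add.int_pow_pow mult.commute)

lemma zp_add: "zp (a + b) = zp a \<oplus>\<^bsub>Zp p\<^esub> zp b"
  by (simp add: Zp.add.int_pow_mult)

lemma zp_unit: "coprime b (int p) \<Longrightarrow> b > 0 \<Longrightarrow> zp b \<in> Units (Zp p)"
  using Zp_unit_of_nat[of "nat b"] by (simp add: add_pow_int_ge flip: coprime_int_iff)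

text \<open>The reduced denominator divides every denominator, in particular one that is prime to
  \<open>p\<close>.\<close>

lemma quotient_of_pint:
  assumes "q \<in> pint p 0" "quotient_of q = (a, b)"
  shows "b > 0" "coprime b (int p)" "of_int a = of_int b * q"
proof -
  show b: "b > 0" using quotient_of_denom_pos[OF assms(2)] .
  have q: "q = of_int a / of_int b" using quotient_of_div[OF assms(2)] .
  then show "of_int a = of_int b * q" using b by simp
  from assms(1) obtain c d where cd: "q = of_int c / of_int d" "coprime d (int p)" "d \<noteq> 0"
    by (elim pintE) auto
  have "(of_int (a * d) :: rat) = of_int (c * b)" using q cd b by (simp add: field_simps)
  then have "a * d = c * b" by (simp only: of_int_eq_iff)
  moreover have "coprime a b" using quotient_of_coprime[OF assms(2)] .
  ultimately have "b dvd d" by (metis coprime_commute coprime_dvd_mult_right_iff dvd_triv_right)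
  then show "coprime b (int p)" using cd(2) by (meson coprime_divisors dvd_refl)
qed

lemma Zp_of_rat_closed: "q \<in> pint p 0 \<Longrightarrow> Zp_of_rat p q \<in> carrier (Zp p)"
  using quotient_of_pint[of q] zp_unit by (cases "quotient_of q") (auto simp: Zp_of_rat_def)

text \<open>Any fraction \<open>c / e\<close> with \<open>e\<close> prime to \<open>p\<close>
  determines the value, not only the reduced one. Sums and products need this, as the product of two
  reduced denominators need not be reduced.\<close>

lemma Zp_of_rat_eqI:
  assumes "q \<in> pint p 0" "z \<in> carrier (Zp p)" "coprime e (int p)" "e > 0"
    and z: "zp e \<otimes>\<^bsub>Zp p\<^esub> z = zp c" and c: "of_int c = of_int e * q"
  shows "Zp_of_rat p q = z"
proof -
  obtain a b where ab: "quotient_of q = (a, b)" by force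
  note b = quotient_of_pint[OF assms(1) ab]
  have u: "zp b \<in> Units (Zp p)" "zp e \<in> Units (Zp p)" using b assms by (auto intro: zp_unit)
  have "(of_int (c * b) :: rat) = of_int (a * e)" using b(3) c by simp
  then have cb: "c * b = a * e" by (simp only: of_int_eq_iff)
  have "zp a = zp b \<otimes>\<^bsub>Zp p\<^esub> z"
  proof -
    have "zp e \<otimes>\<^bsub>Zp p\<^esub> (zp b \<otimes>\<^bsub>Zp p\<^esub> z) = zp b \<otimes>\<^bsub>Zp p\<^esub> zp c"
      using assms(2) z[symmetric] Zp.m_lcomm by simp
    also have "\<dots> = zp e \<otimes>\<^bsub>Zp p\<^esub> zp a" using cb by (simp add: mult.commute flip: zp_mult)
    finally show ?thesis using u assms(2) Zp.Units_l_cancel[OF u(2)] by simp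
  qed
  then have "Zp_of_rat p q = (zp b \<otimes>\<^bsub>Zp p\<^esub> z) \<otimes>\<^bsub>Zp p\<^esub> inv\<^bsub>Zp p\<^esub> zp b"
    by (simp add: Zp_of_rat_def ab)
  also have "\<dots> = (zp b \<otimes>\<^bsub>Zp p\<^esub> inv\<^bsub>Zp p\<^esub> zp b) \<otimes>\<^bsub>Zp p\<^esub> z"
    using u assms(2) by (simp add: Zp.m_ac)
  finally show ?thesis using u assms(2) by simp
qed

lemma Zp_of_rat_denom:
  assumes "q \<in> pint p 0"
  obtains e c where "coprime e (int p)" "e > 0" "zp e \<otimes>\<^bsub>Zp p\<^esub> Zp_of_rat p q = zp c" "of_int c = of_int e * q"
proof -
  obtain a b where ab: "quotient_of q = (a, b)" by force
  note b = quotient_of_pint[OF assms(1) ab]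
  have u: "zp b \<in> Units (Zp p)" using b by (auto intro: zp_unit)
  have "zp b \<otimes>\<^bsub>Zp p\<^esub> Zp_of_rat p q = zp a \<otimes>\<^bsub>Zp p\<^esub> (zp b \<otimes>\<^bsub>Zp p\<^esub> inv\<^bsub>Zp p\<^esub> zp b)"
    using u by (simp add: Zp_of_rat_def ab Zp.m_lcomm)
  then have "zp b \<otimes>\<^bsub>Zp p\<^esub> Zp_of_rat p q = zp a" using u by simp
  with b that show thesis by blast
qed

lemma Zp_of_rat_of_int: "Zp_of_rat p (of_int z) = zp z"
  by (rule Zp_of_rat_eqI[of _ _ 1 z]) simp_all

lemma Zp_of_rat_0 [simp]: "Zp_of_rat p 0 = \<zero>\<^bsub>Zp p\<^esub>"
  using Zp_of_rat_of_int[of 0] by (simp add: add_pow_int_ge)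

lemma Zp_of_rat_1 [simp]: "Zp_of_rat p 1 = \<one>\<^bsub>Zp p\<^esub>"
  using Zp_of_rat_of_int[of 1] by simp

lemma Zp_of_rat_mult:
  assumes "q \<in> pint p 0" "r \<in> pint p 0"
  shows "Zp_of_rat p (q * r) = Zp_of_rat p q \<otimes>\<^bsub>Zp p\<^esub> Zp_of_rat p r"
proof -
  obtain e c e' c' where 
    1: "coprime e (int p)" "e > 0" "zp e \<otimes>\<^bsub>Zp p\<^esub> Zp_of_rat p q = zp c" "of_int c = of_int e * q" and
    2: "coprime e' (int p)" "e' > 0" "zp e' \<otimes>\<^bsub>Zp p\<^esub> Zp_of_rat p r = zp c'" "of_int c' = of_int e' * r"
    using Zp_of_rat_denom[OF assms(1)] Zp_of_rat_denom[OF assms(2)] by metis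
  note cl = Zp_of_rat_closed[OF assms(1)] Zp_of_rat_closed[OF assms(2)]
  show ?thesis
  proof (rule Zp_of_rat_eqI[of _ _ "e * e'" "c * c'"])
    show "zp (e * e') \<otimes>\<^bsub>Zp p\<^esub> (Zp_of_rat p q \<otimes>\<^bsub>Zp p\<^esub> Zp_of_rat p r) = zp (c * c')"
      unfolding zp_mult 1(3)[symmetric] 2(3)[symmetric] using cl by (simp add: Zp.m_ac)
  qed (use 1 2 cl assms in \<open>auto intro: pint_mult0\<close>)
qed

lemma Zp_of_rat_add:
  assumes "q \<in> pint p 0" "r \<in> pint p 0"
  shows "Zp_of_rat p (q + r) = Zp_of_rat p q \<oplus>\<^bsub>Zp p\<^esub> Zp_of_rat p r"
proof -
  obtain e c e' c' where 
    1: "coprime e (int p)" "e > 0" "zp e \<otimes>\<^bsub>Zp p\<^esub> Zp_of_rat p q = zp c" "of_int c = of_int e * q" and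
    2: "coprime e' (int p)" "e' > 0" "zp e' \<otimes>\<^bsub>Zp p\<^esub> Zp_of_rat p r = zp c'" "of_int c' = of_int e' * r"
    using Zp_of_rat_denom[OF assms(1)] Zp_of_rat_denom[OF assms(2)] by metis
  note cl = Zp_of_rat_closed[OF assms(1)] Zp_of_rat_closed[OF assms(2)]
  show ?thesis
  proof (rule Zp_of_rat_eqI[of _ _ "e * e'" "c * e' + e * c'"])
    show "zp (e * e') \<otimes>\<^bsub>Zp p\<^esub> (Zp_of_rat p q \<oplus>\<^bsub>Zp p\<^esub> Zp_of_rat p r) = zp (c * e' + e * c')"
      unfolding zp_mult zp_add 1(3)[symmetric] 2(3)[symmetric] using cl by (simp add: Zp.m_ac Zp.r_distr)
  qed (use 1 2 cl assms in \<open>auto intro: pint_add simp: algebra_simps\<close>)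
qed

lemma Zp_of_rat_sum:
  assumes "finite X" "\<And>i. i \<in> X \<Longrightarrow> f i \<in> pint p 0"
  shows "Zp_of_rat p (sum f X) = (\<Oplus>\<^bsub>Zp p\<^esub>i\<in>X. Zp_of_rat p (f i))"
  using assms
proof (induction X rule: finite_induct)
  case (insert x X)
  then have "Zp_of_rat p (sum f (insert x X)) = Zp_of_rat p (f x) \<oplus>\<^bsub>Zp p\<^esub> (\<Oplus>\<^bsub>Zp p\<^esub>i\<in>X. Zp_of_rat p (f i))"
    by (simp add: Zp_of_rat_add pint_sum)
  also have "\<dots> = (\<Oplus>\<^bsub>Zp p\<^esub>i\<in>insert x X. Zp_of_rat p (f i))"
    using insert by (intro Zp.finsum_insert[symmetric]) (auto intro: Zp_of_rat_closed)
  finally show ?case .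
qed simp

section \<open>Rational power series as Laurent series over \<open>Z_p\<close>\<close>

abbreviation lau :: "rat fps \<Rightarrow> int \<Rightarrow> padic" where "lau \<equiv> Zp_laurent_of_fps p"

lemma lau_nth_closed: "f \<in> Ifps 0 \<Longrightarrow> lau f k \<in> carrier (Zp p)"
  by (auto simp: Zp_laurent_of_fps_def Ifps_def intro: Zp_of_rat_closed)

lemma lau_closed: "f \<in> Ifps 0 \<Longrightarrow> lau f \<in> carrier (Zp_laurent p)"
  using lau_nth_closed[of f] 
  by (auto simp: Zp_laurent_def laurent_series_ring_def Zp_laurent_of_fps_def intro!: exI[of _ 0])

lemma lau_add: "f \<in> Ifps 0 \<Longrightarrow> g \<in> Ifps 0 \<Longrightarrow> lau (f + g) = lau f \<oplus>\<^bsub>Zp_laurent p\<^esub> lau g"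
  by (rule ext) (auto simp: Zp_laurent_def laurent_series_ring_def Zp_laurent_of_fps_def Zp_of_rat_add Ifps_def)

lemma lau_mult:
  assumes f: "f \<in> Ifps 0" and g: "g \<in> Ifps 0"
  shows "lau (f * g) = lau f \<otimes>\<^bsub>Zp_laurent p\<^esub> lau g"
proof
  fix k
  have range: "range (lau f) \<subseteq> carrier (Zp p)" "range (lau g) \<subseteq> carrier (Zp p)"
    using f g by (auto intro: lau_nth_closed)
  show "lau (f * g) k = (lau f \<otimes>\<^bsub>Zp_laurent p\<^esub> lau g) k"
  proof (cases "k < 0")
    case True
    \<comment> \<open>For negative \<open>k\<close> one of \<open>i\<close> and \<open>k - i\<close>
      is negative, so no term survives.\<close>
    have "(lau f \<otimes>\<^bsub>Zp_laurent p\<^esub> lau g) k = (\<Oplus>\<^bsub>Zp p\<^esub>i\<in>{}. lau f i \<otimes>\<^bsub>Zp p\<^esub> lau g (k - i))"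
      unfolding Zp_laurent_def
      by (rule laurent_mult_eq[OF cring_Zp]) 
        (use True range in \<open>auto simp: Zp_laurent_of_fps_def split: if_splits\<close>)
    then show ?thesis using True by (simp add: Zp_laurent_of_fps_def)
  next
    case False
    then obtain m where m: "k = int m" by (metis not_less zero_le_imp_eq_int)
    have "(lau f \<otimes>\<^bsub>Zp_laurent p\<^esub> lau g) k = (\<Oplus>\<^bsub>Zp p\<^esub>i\<in>int ` {0..m}. lau f i \<otimes>\<^bsub>Zp p\<^esub> lau g (k - i))"
      unfolding Zp_laurent_def
      by (rule laurent_mult_eq[OF cring_Zp]) 
        (use range in \<open>auto simp: m image_int_atLeastAtMost Zp_laurent_of_fps_def split: if_splits\<close>)
    also have "\<dots> = (\<Oplus>\<^bsub>Zp p\<^esub>i\<in>{0..m}. lau f (int i) \<otimes>\<^bsub>Zp p\<^esub> lau g (k - int i))"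
      by (rule Zp.finsum_reindex) (use f g in \<open>auto intro: lau_nth_closed\<close>)
    also have "\<dots> = (\<Oplus>\<^bsub>Zp p\<^esub>i\<in>{0..m}. Zp_of_rat p (fps_nth f i * fps_nth g (m - i)))"
    proof (rule Zp.finsum_cong')
      fix i assume "i \<in> {0..m}"
      then have "\<not> k - int i < 0" "nat (k - int i) = m - i" by (auto simp: m)
      then show "lau f (int i) \<otimes>\<^bsub>Zp p\<^esub> lau g (k - int i) = Zp_of_rat p (fps_nth f i * fps_nth g (m - i))"
        using f g by (simp add: Zp_laurent_of_fps_def Zp_of_rat_mult Ifps_def)
    qed (use f g in \<open>auto simp: Ifps_def intro!: Zp_of_rat_closed pint_mult0\<close>)
    also have "\<dots> = Zp_of_rat p (\<Sum>i=0..m. fps_nth f i * fps_nth g (m - i))"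
      by (rule Zp_of_rat_sum[symmetric]) (use f g in \<open>auto simp: Ifps_def intro!: pint_mult0\<close>)
    finally show ?thesis by (simp add: m Zp_laurent_of_fps_def fps_mult_nth)
  qed
qed

lemma lau_const: "lau (fps_const c) = laurent_const (Zp p) (Zp_of_rat p c)"
  by (rule ext) (auto simp: Zp_laurent_of_fps_def laurent_const_def)

lemma lau_1: "lau 1 = \<one>\<^bsub>Zp_laurent p\<^esub>"
  by (rule ext) (auto simp: Zp_laurent_of_fps_def Zp_laurent_def laurent_series_ring_def)

lemma lau_0: "lau 0 = \<zero>\<^bsub>Zp_laurent p\<^esub>"
  by (rule ext) (auto simp: Zp_laurent_of_fps_def Zp_laurent_def laurent_series_ring_def)

lemma lau_X: "lau fps_X = laurent_X (Zp p)"
  by (rule ext) (auto simp: Zp_laurent_of_fps_def laurent_X_def fps_X_def)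

lemma lau_of_nat: "lau (of_nat m) = [m] \<cdot>\<^bsub>Zp_laurent p\<^esub> \<one>\<^bsub>Zp_laurent p\<^esub>"
proof (induction m)
  case (Suc m)
  have "(of_nat m :: rat fps) \<in> Ifps 0" using Ifps_const[of "of_nat m" 0] by (simp add: fps_of_nat)
  then have "lau (of_nat m + 1) = lau (of_nat m) \<oplus>\<^bsub>Zp_laurent p\<^esub> lau 1" by (intro lau_add) simp_all
  then show ?case using Suc by (simp add: lau_1 add.commute)
qed (simp add: lau_0)

lemma lau_power: "f \<in> Ifps 0 \<Longrightarrow> lau (f ^ m) = lau f [^]\<^bsub>Zp_laurent p\<^esub> m"
proof (induction m)
  case (Suc m)
  then show ?case by (simp add: power_Suc2 lau_mult Ifps_power0 del: power_Suc)
qed (simp add: lau_1)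

lemma Ifps_divide_power_p:
  assumes "f \<in> Ifps k"
  shows "f = of_nat (p ^ k) * (fps_const (1 / of_nat (p ^ k)) * f)"
    and "fps_const (1 / of_nat (p ^ k)) * f \<in> Ifps 0"
proof -
  show "f = of_nat (p ^ k) * (fps_const (1 / of_nat (p ^ k)) * f)"
    using p_pos by (simp add: mult.assoc[symmetric] del: p_pos flip: fps_of_nat)
  show "fps_const (1 / of_nat (p ^ k)) * f \<in> Ifps 0"
    using assms pint_cancel_p[of k _ 0] p_pos by (auto simp: Ifps_def simp del: p_pos)
qed

lemma of_nat_Ifps: "of_nat m \<in> Ifps 0"
  using Ifps_const[of "of_nat m" 0] by (simp add: fps_of_nat)

lemma lau_p_power_ideal:
  assumes "f \<in> Ifps k"
  shows "lau f \<in> p_power_ideal (Zp_laurent p) p k"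
proof -
  let ?g = "fps_const (1 / of_nat (p ^ k)) * f"
  have "lau f = lau (?g * of_nat (p ^ k))"
    by (metis Ifps_divide_power_p(1)[OF assms] mult.commute)
  also have "\<dots> = lau ?g \<otimes>\<^bsub>Zp_laurent p\<^esub> lau (of_nat (p ^ k))"
    by (intro lau_mult Ifps_divide_power_p(2) assms of_nat_Ifps)
  finally show ?thesis
    unfolding mem_p_power_ideal lau_of_nat using Ifps_divide_power_p(2)[OF assms] lau_closed by blast
qed

lemma laurent_X_unit: "laurent_X (Zp p) \<in> Units (Zp_laurent p)"
proof -
  define Y where "Y = (\<lambda>k::int. if k = -1 then \<one>\<^bsub>Zp p\<^esub> else \<zero>\<^bsub>Zp p\<^esub>)"
  have Y: "Y \<in> carrier (Zp_laurent p)"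
    by (auto simp: Y_def Zp_laurent_def laurent_series_ring_def intro!: exI[of _ "-1"])
  have X: "laurent_X (Zp p) \<in> carrier (Zp_laurent p)"
    using lau_closed[of fps_X] by (simp add: lau_X)
  have "laurent_X (Zp p) \<otimes>\<^bsub>Zp_laurent p\<^esub> Y = \<one>\<^bsub>Zp_laurent p\<^esub>"
  proof
    fix k
    have "(laurent_X (Zp p) \<otimes>\<^bsub>Zp_laurent p\<^esub> Y) k = (\<Oplus>\<^bsub>Zp p\<^esub>i\<in>{1}. laurent_X (Zp p) i \<otimes>\<^bsub>Zp p\<^esub> Y (k - i))"
      unfolding Zp_laurent_def
      by (rule laurent_mult_eq[OF cring_Zp]) (auto simp: laurent_X_def Y_def split: if_splits)
    then show "(laurent_X (Zp p) \<otimes>\<^bsub>Zp_laurent p\<^esub> Y) k = \<one>\<^bsub>Zp_laurent p\<^esub> k"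
      by (simp add: laurent_X_def Y_def Zp_laurent_def laurent_series_ring_def)
  qed
  then show ?thesis using X Y L.m_comm[OF X Y] by (auto simp: Units_def)
qed

lemma lau_inverse:
  assumes "f \<in> Ifps 0" "fps_nth f 0 = 1"
  shows "lau f \<in> Units (Zp_laurent p)" "inv\<^bsub>Zp_laurent p\<^esub> lau f = lau (inverse f)"
proof -
  have i: "inverse f \<in> Ifps 0" using assms by (rule Ifps_inverse)
  have "f * inverse f = 1" using assms by (simp add: inverse_mult_eq_1')
  then have 1: "lau f \<otimes>\<^bsub>Zp_laurent p\<^esub> lau (inverse f) = \<one>\<^bsub>Zp_laurent p\<^esub>"
    using lau_mult[OF assms(1) i] by (simp add: lau_1)
  then show "inv\<^bsub>Zp_laurent p\<^esub> lau f = lau (inverse f)"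
    using lau_closed assms i by (intro L.comm_inv_char) auto
  show "lau f \<in> Units (Zp_laurent p)"
    using 1 lau_closed[OF assms(1)] lau_closed[OF i] L.m_comm[of "lau (inverse f)" "lau f"]
    by (auto simp: Units_def)
qed

end

section \<open>Approximation of \<open>f_i\<close> by fractions with denominator a power of
  \<open>x (1 - x) H\<close>\<close>

context hypergeometric
begin

interpretation Zp: cring "Zp p" by (rule cring_Zp)

interpretation L: cring "Zp_laurent p" by (rule cring_Zp_laurent)

abbreviation "D \<equiv> fps_X * (1 - fps_X) * hyp_H n p"

lemma D_ipoly: "D \<in> ipoly"
  using H_ipoly by (intro ipoly_mult ipoly_diff) (simp_all add: H_eq)

text \<open>The cofactor of \<open>x\<close> is a power series with constant term \<open>1\<close>,
  and \<open>x\<close> itself is invertible among Laurent series.\<close>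

lemma lau_D_unit: "lau D \<in> Units (Zp_laurent p)"
proof -
  have H: "hyp_H n p \<in> ipoly" "fps_nth (hyp_H n p) 0 = 1" using H_ipoly H_0 by (simp_all add: H_eq)
  then have I: "(1 - fps_X) * hyp_H n p \<in> Ifps 0" by (intro ipoly_Ifps ipoly_mult ipoly_diff) simp_all
  have "lau D = lau fps_X \<otimes>\<^bsub>Zp_laurent p\<^esub> lau ((1 - fps_X) * hyp_H n p)"
    unfolding mult.assoc by (intro lau_mult I) simp
  moreover have "lau ((1 - fps_X) * hyp_H n p) \<in> Units (Zp_laurent p)"
    using H by (intro lau_inverse I) simp
  ultimately show ?thesis using laurent_X_unit by (simp add: lau_X)
qed

definition W :: "int \<Rightarrow> padic" where "W = inv\<^bsub>Zp_laurent p\<^esub> lau D"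

definition G :: "(int \<Rightarrow> padic) set" where
  "G = generate_ring (Zp_laurent p) (laurent_const (Zp p) ` carrier (Zp p) \<union> {laurent_X (Zp p), W})"

lemma hyp_ring_eq: "hyp_ring n p = (Zp_laurent p)\<lparr>carrier := G\<rparr>"
  by (simp add: hyp_ring_def G_def W_def)

lemma W_closed: "W \<in> carrier (Zp_laurent p)"
  unfolding W_def using lau_D_unit by simp

lemma W_D: "lau D \<otimes>\<^bsub>Zp_laurent p\<^esub> W = \<one>\<^bsub>Zp_laurent p\<^esub>"
  unfolding W_def using lau_D_unit by simp

lemma G_subring: "subring G (Zp_laurent p)"
  unfolding G_def
proof (rule L.generate_ring_is_subring)
  have "laurent_X (Zp p) \<in> carrier (Zp_laurent p)"
    using lau_closed[of fps_X] by (simp add: lau_X)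
  moreover have "laurent_const (Zp p) c \<in> carrier (Zp_laurent p)" if "c \<in> carrier (Zp p)" for c
    using that by (auto simp: Zp_laurent_def laurent_series_ring_def laurent_const_def intro!: exI[of _ 0])
  ultimately show "laurent_const (Zp p) ` carrier (Zp p) \<union> {laurent_X (Zp p), W} \<subseteq> carrier (Zp_laurent p)"
    using W_closed by auto
qed

lemma W_G: "W \<in> G"
  unfolding G_def by (rule generate_ring.incl) simp

lemma W_power_G: "W [^]\<^bsub>Zp_laurent p\<^esub> (m :: nat) \<in> G"
  by (induction m) (auto intro: W_G subringE(3,6)[OF G_subring])

lemma ipoly_G:
  assumes "f \<in> ipoly" shows "lau f \<in> G"
  using assms
proof (induction rule: ipoly_induct)
  case (const c)
  then show ?case unfolding lau_const G_def
    by (intro generate_ring.incl) (auto intro: Zp_of_rat_closed)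
next
  case (mult_X c f)
  have "lau (fps_const c) \<in> G" unfolding lau_const G_def
    using mult_X by (intro generate_ring.incl) (auto intro: Zp_of_rat_closed)
  moreover have "lau fps_X \<in> G" unfolding lau_X G_def by (rule generate_ring.incl) simp
  ultimately show ?case
    using mult_X subringE(6,7)[OF G_subring]
    by (simp add: lau_add lau_mult ipoly_Ifps Ifps_const Ifps_mult0)
qed

lemma lau_D_power_W: "lau (D ^ m) \<otimes>\<^bsub>Zp_laurent p\<^esub> W [^]\<^bsub>Zp_laurent p\<^esub> m = \<one>\<^bsub>Zp_laurent p\<^esub>"
  using L.nat_pow_distrib[OF lau_closed[OF ipoly_Ifps[OF D_ipoly]] W_closed, of m] W_D
  by (simp add: lau_power ipoly_Ifps D_ipoly)

lemma hyp_f_eq: "hyp_f n p i = lau ((fps_deriv ^^ i) (hyp_F n) * inverse (hyp_F n))"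
  and hyp_quotient_Ifps: "(fps_deriv ^^ i) (hyp_F n) * inverse (hyp_F n) \<in> Ifps 0"
proof -
  have F: "hyp_F n \<in> Ifps 0" "fps_nth (hyp_F n) 0 = 1" using F_Ifps F_0 by (simp_all add: F_eq)
  have Fi: "(fps_deriv ^^ i) (hyp_F n) \<in> Ifps 0"
    using F pint_diff[OF pint_of_nat pint_of_nat]
    by (auto simp: Ifps_def fps_nth_iterated_deriv intro!: pint_mult0 pint_prod simp del: of_nat_add)
  show "hyp_f n p i = lau ((fps_deriv ^^ i) (hyp_F n) * inverse (hyp_F n))"
    unfolding hyp_f_def lau_inverse(2)[OF F] by (intro lau_mult[symmetric] Fi Ifps_inverse F)
  show "(fps_deriv ^^ i) (hyp_F n) * inverse (hyp_F n) \<in> Ifps 0"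
    by (intro Ifps_mult0 Fi Ifps_inverse F)
qed

text \<open>With \<open>W\<close> as \<open>1 / D\<close>, this expands the fraction
  \<open>f / D ^ l\<close> by \<open>D ^ m\<close>; it serves to reach common denominators.\<close>

lemma lau_cancel_D:
  assumes "f \<in> Ifps 0"
  shows "lau (D ^ m * f) \<otimes>\<^bsub>Zp_laurent p\<^esub> W [^]\<^bsub>Zp_laurent p\<^esub> (m + l) = lau f \<otimes>\<^bsub>Zp_laurent p\<^esub> W [^]\<^bsub>Zp_laurent p\<^esub> l"
proof -
  have D: "D ^ m \<in> Ifps 0" by (intro Ifps_power0 ipoly_Ifps D_ipoly)
  note cl = lau_closed[OF D] lau_closed[OF assms] W_closed
  have "lau (D ^ m * f) \<otimes>\<^bsub>Zp_laurent p\<^esub> W [^]\<^bsub>Zp_laurent p\<^esub> (m + l) =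
    (lau (D ^ m) \<otimes>\<^bsub>Zp_laurent p\<^esub> W [^]\<^bsub>Zp_laurent p\<^esub> m) \<otimes>\<^bsub>Zp_laurent p\<^esub> (lau f \<otimes>\<^bsub>Zp_laurent p\<^esub> W [^]\<^bsub>Zp_laurent p\<^esub> l)"
    using cl by (simp add: lau_mult[OF D assms] L.m_ac flip: L.nat_pow_mult)
  then show ?thesis unfolding lau_D_power_W using cl by simp
qed

theorem hyp_f_in_completion:
  "to_completion (Zp_laurent p) p (hyp_f n p i)
     \<in> completion_map (Zp_laurent p) p ` carrier (p_adic_completion (hyp_ring n p) p)"
proof -
  define u where "u = (fps_deriv ^^ i) (hyp_F n) * inverse (hyp_F n)"
  have "\<exists>m Q. Q \<in> ipoly \<and> D ^ m * u - Q \<in> Ifps k" for k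
    using hyp_quotient_approx[of i k] unfolding u_def by blast
  then obtain m Q where Q: "\<And>k. Q k \<in> ipoly" and mQ: "\<And>k. D ^ m k * u - Q k \<in> Ifps k"
    by metis
  have u: "u \<in> Ifps 0" unfolding u_def by (rule hyp_quotient_Ifps)
  have QI: "Q k \<in> Ifps 0" for k using Q by (rule ipoly_Ifps)
  have DI: "D ^ j \<in> Ifps 0" for j by (intro Ifps_power0 ipoly_Ifps D_ipoly)
  \<comment> \<open>The approximants are the fractions \<open>Q k / D ^ m k\<close>, which lie in
    \<open>G\<close>.\<close>
  define g where "g k = lau (Q k) \<otimes>\<^bsub>Zp_laurent p\<^esub> W [^]\<^bsub>Zp_laurent p\<^esub> m k" for k
  show ?thesis unfolding hyp_ring_eq
  proof (rule to_completion_in_subring_completion[where g = g])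
    show "g k \<in> G" for k unfolding g_def
      by (intro subringE(6)[OF G_subring] ipoly_G Q W_power_G)
  next
    fix k
    let ?d = "D ^ m k * u - Q k"
    have d0: "?d \<in> Ifps 0" using mQ by (rule Ifps_mono) simp
    \<comment> \<open>The trivial power of \<open>W\<close> prepares the expansion by
      \<open>D ^ m k\<close> with \<open>l = 0\<close>.\<close>
    have "hyp_f n p i = lau u \<otimes>\<^bsub>Zp_laurent p\<^esub> W [^]\<^bsub>Zp_laurent p\<^esub> (0 :: nat)"
      using lau_closed[OF u] by (simp add: hyp_f_eq u_def)
    also have "\<dots> = lau (?d + Q k) \<otimes>\<^bsub>Zp_laurent p\<^esub> W [^]\<^bsub>Zp_laurent p\<^esub> m k"
      using lau_cancel_D[OF u, of "m k" 0] by simp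
    also have "\<dots> = lau ?d \<otimes>\<^bsub>Zp_laurent p\<^esub> W [^]\<^bsub>Zp_laurent p\<^esub> m k \<oplus>\<^bsub>Zp_laurent p\<^esub> g k"
      unfolding lau_add[OF d0 QI] g_def using lau_closed[OF d0] lau_closed[OF QI] W_closed by (intro L.l_distr) auto
    finally have e: "hyp_f n p i = \<dots>" .
    have "lau ?d \<otimes>\<^bsub>Zp_laurent p\<^esub> W [^]\<^bsub>Zp_laurent p\<^esub> m k \<in> p_power_ideal (Zp_laurent p) p k"
      using ideal.I_r_closed[OF p_power_ideal_ideal[OF cring_Zp_laurent] lau_p_power_ideal[OF mQ]] W_closed by simp
    then show "\<exists>d\<in>p_power_ideal (Zp_laurent p) p k. hyp_f n p i = d \<oplus>\<^bsub>Zp_laurent p\<^esub> g k"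
      using e by blast
  next
    fix k
    \<comment> \<open>The numerator of \<open>g (Suc k) - g k\<close> over the common denominator
      \<open>D ^ ?M\<close>.\<close>
    let ?d = "D ^ m k * Q (Suc k) - D ^ m (Suc k) * Q k"
    let ?e = "fps_const (1 / of_nat (p ^ k)) * ?d"
    let ?M = "m k + m (Suc k)"
    \<comment> \<open>The terms with \<open>u\<close> cancel, so the two error bounds make
      \<open>?d\<close> divisible by \<open>p ^ k\<close>.\<close>
    have "?d = D ^ m (Suc k) * (D ^ m k * u - Q k) - D ^ m k * (D ^ m (Suc k) * u - Q (Suc k))"
      by (simp add: algebra_simps)
    also have "\<dots> \<in> Ifps k"
      by (intro Ifps_diff Ifps_mult0(2) DI mQ Ifps_mono[OF mQ[of "Suc k"]]) simp
    finally have d: "?d \<in> Ifps k" .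
    have e0: "?e \<in> Ifps 0" by (rule Ifps_divide_power_p(2)) (rule d)
    \<comment> \<open>As \<open>?d\<close> is a polynomial, so is \<open>?e\<close>, its quotient by
      \<open>p ^ k\<close>. Hence \<open>g (Suc k) - g k\<close> is \<open>p ^ k\<close> times the
      element \<open>z\<close> of \<open>G\<close> itself, and not merely of the Laurent series
      ring.\<close>
    have "?d \<in> ipoly" by (intro ipoly_diff ipoly_mult ipoly_power D_ipoly Q)
    then obtain P where "?d = fps_of_poly P" by (auto simp: ipoly_def)
    then have "?e = fps_of_poly (smult (1 / of_nat (p ^ k)) P)" by (simp only: fps_of_poly_smult)
    then have e: "?e \<in> ipoly" using e0 by (auto simp: ipoly_def)
    have DQ: "D ^ m (Suc k) * Q k \<in> Ifps 0" by (intro Ifps_mult0 DI QI)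
    define z where "z = lau ?e \<otimes>\<^bsub>Zp_laurent p\<^esub> W [^]\<^bsub>Zp_laurent p\<^esub> ?M"
    have z: "z \<in> G" unfolding z_def by (intro subringE(6)[OF G_subring] ipoly_G e W_power_G)
    define pk where "pk = [(p ^ k)] \<cdot>\<^bsub>Zp_laurent p\<^esub> \<one>\<^bsub>Zp_laurent p\<^esub>"
    have pk: "lau (of_nat (p ^ k)) = pk" unfolding pk_def by (rule lau_of_nat)
    have cl: "lau ?e \<in> carrier (Zp_laurent p)" "pk \<in> carrier (Zp_laurent p)"
        "lau (D ^ m (Suc k) * Q k) \<in> carrier (Zp_laurent p)" "W [^]\<^bsub>Zp_laurent p\<^esub> ?M \<in> carrier (Zp_laurent p)"
      using W_closed lau_closed[OF e0] lau_closed[OF DQ] by (simp_all add: pk_def)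
    have "g (Suc k) = lau (D ^ m k * Q (Suc k)) \<otimes>\<^bsub>Zp_laurent p\<^esub> W [^]\<^bsub>Zp_laurent p\<^esub> ?M"
      unfolding g_def by (rule lau_cancel_D[symmetric]) (rule QI)
    also have "D ^ m k * Q (Suc k) = of_nat (p ^ k) * ?e + D ^ m (Suc k) * Q k"
      unfolding Ifps_divide_power_p(1)[OF d, symmetric] by simp
    also have "lau \<dots> = (pk \<otimes>\<^bsub>Zp_laurent p\<^esub> lau ?e) \<oplus>\<^bsub>Zp_laurent p\<^esub> lau (D ^ m (Suc k) * Q k)"
      by (simp only: lau_add[OF Ifps_mult0(1)[OF of_nat_Ifps e0] DQ] lau_mult[OF of_nat_Ifps e0] pk)
    also have "\<dots> \<otimes>\<^bsub>Zp_laurent p\<^esub> W [^]\<^bsub>Zp_laurent p\<^esub> ?M = 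
        z \<otimes>\<^bsub>Zp_laurent p\<^esub> pk \<oplus>\<^bsub>Zp_laurent p\<^esub> lau (D ^ m (Suc k) * Q k) \<otimes>\<^bsub>Zp_laurent p\<^esub> W [^]\<^bsub>Zp_laurent p\<^esub> ?M"
      unfolding z_def using cl by (simp only: L.l_distr L.m_closed L.m_ac)
    also have "lau (D ^ m (Suc k) * Q k) \<otimes>\<^bsub>Zp_laurent p\<^esub> W [^]\<^bsub>Zp_laurent p\<^esub> ?M = g k"
      unfolding g_def add.commute[of "m k"] by (rule lau_cancel_D) (rule QI)
    finally have "g (Suc k) = z \<otimes>\<^bsub>Zp_laurent p\<^esub> pk \<oplus>\<^bsub>Zp_laurent p\<^esub> g k" .
    moreover have "z \<otimes>\<^bsub>Zp_laurent p\<^esub> pk \<in> p_power_ideal (Zp_laurent p\<lparr>carrier := G\<rparr>) p k"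
      using z by (auto simp: mem_p_power_ideal add_pow_update_carrier pk_def)
    ultimately show "\<exists>d\<in>p_power_ideal (Zp_laurent p\<lparr>carrier := G\<rparr>) p k. g (Suc k) = d \<oplus>\<^bsub>Zp_laurent p\<^esub> g k"
      by blast
  qed (rule cring_Zp_laurent G_subring)+
qed

end

theorem proposition4p4:
  fixes n p :: nat
  assumes "n \<ge> 2" and "prime p" and "coprime p (n + 1)"
  shows "\<forall>i::nat. to_completion (Zp_laurent p) p (hyp_f n p i)
           \<in> completion_map (Zp_laurent p) p ` carrier (p_adic_completion (hyp_ring n p) p)"
proof -
  interpret hypergeometric p n
    by unfold_locales (use assms in auto)
  show ?thesis using hyp_f_in_completion by blast
qed

end
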